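(* For integers $n\ge 1$ and $k\ge 0$, let $M_n^2(k)$ denote the expected number of vertices of the random graph $G_1^n$ whose second degree equals $k$. For any $k>1$, $$M_n^2(k) = \frac{4n}{k^2}\left(1 + O\left(\frac{\ln^2 k}{k}\right) + O\left(\frac{k^2}{n}\right)\right),$$ where the implied constants are absolute. That is, there is an absolute constant $C>0$ such that for all integers $n\ge 1$ and $k\ge 2$ one has $M_n^2(k)=\frac{4n}{k^2}(1+E)$ for some real $E=E(n,k)$ with $|E|\le C\left(\frac{\ln^2 k}{k}+\frac{k^2}{n}\right)$.
   Context: The Bollob\'as--Riordan random graph $G_1^n$ (case $m=1$) on the vertex set $\{1,\dots,n\}$ is constructed inductively. $G_1^1$ is the graph with one vertex $1$ and one loop at it. Given $G_1^{t-1}$ ($t\ge 2$), the graph $G_1^t$ is obtained by adding the vertex $t$ and one edge between $t$ and $i$, where $i\in\{1,\dots,t\}$ is chosen randomly (conditionally on $G_1^{t-1}$) with $$\mathrm{P}(i=s)=\begin{cases} d_{G_1^{t-1}}(s)/(2t-1), & 1\le s\le t-1,\\ 1/(2t-1), & s=t.\end{cases}$$ Here $d_{G}(s)$ is the degree of the vertex $s$ in $G$; a loop contributes $2$ to the degree. If $i=t$ the new edge is a loop at $t$. For a vertex $t\in G_1^n$ the second degree of $t$ is $$d_2(t)=\#\{ij : i\neq t,\ j\neq t,\ it\in G_1^n,\ ij\in G_1^n\},$$ i.e. the number of edges adjacent to the neighbors of $t$, except for the edges adjacent to $t$. A loop at a neighbor $i\ne t$ of $t$ contributes $2$ to $d_2(t)$,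 just as it contributes $2$ to the degree of $i$. (In $G_1^n$ every non-loop edge joins a vertex to an earlier one and each vertex emits one edge, so there are no multiple edges and no non-loop edges between two neighbors of $t$. Thus $d_2(t)=\sum_{i}(d_{G_1^n}(i)-1)$, the sum being over all vertices $i\ne t$ adjacent to $t$.) *)

theory Defs
  imports "HOL-Probability.Probability"
begin

text \<open>
  A multigraph on positive integers is given by its set of edges. An edge is stored as a pair
  (later endpoint, earlier endpoint), and a loop at \<open>v\<close> is the pair \<open>(v, v)\<close>; a set suffices since
  the graphs considered here have no multiple edges. The orientation is only bookkeeping: degrees
  and adjacency below do not depend on it.
\<close>
type_synonym graph = "(nat \<times> nat) set"

text \<open>A loop at \<open>v\<close> lies in both of the sets counted, so it contributes 2.\<close>
definition vertex_degree :: "graph \<Rightarrow> nat \<Rightarrow> nat" where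
  "vertex_degree G v = card {e \<in> G. fst e = v} + card {e \<in> G. snd e = v}"

definition adjacent :: "graph \<Rightarrow> nat \<Rightarrow> nat \<Rightarrow> bool" where
  "adjacent G u v \<longleftrightarrow> (u, v) \<in> G \<or> (v, u) \<in> G"

text \<open>
  The edges \<open>ab\<close> not incident to \<open>t\<close> with at least one endpoint adjacent to \<open>t\<close>, where loops are
  counted twice.
\<close>
definition second_degree :: "graph \<Rightarrow> nat \<Rightarrow> nat" where
  "second_degree G t =
     (\<Sum>(a, b) \<in> {(a, b) \<in> G. a \<noteq> t \<and> b \<noteq> t \<and> (adjacent G a t \<or> adjacent G b t)}.
        if a = b then 2 else 1)"

text \<open>
  The law of the other endpoint of the edge emitted by the new vertex \<open>t\<close>, given the graph \<open>G\<close> on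
  \<open>{1..t - 1}\<close>. The weights do add up to 1 for all graphs to which this is applied, see
  \<open>pmf_attachment\<close> below.
\<close>
definition attachment :: "nat \<Rightarrow> graph \<Rightarrow> nat pmf" where
  "attachment t G = embed_pmf (\<lambda>s.
     if 1 \<le> s \<and> s < t then real (vertex_degree G s) / (2 * real t - 1)
     else if s = t then 1 / (2 * real t - 1)
     else 0)"

text \<open>The value at \<open>0\<close> is a dummy.\<close>
fun bollobas_riordan :: "nat \<Rightarrow> graph pmf" where
  "bollobas_riordan 0 = return_pmf {}"
| "bollobas_riordan (Suc 0) = return_pmf {(1, 1)}"
| "bollobas_riordan (Suc (Suc m)) =
     do {
       G \<leftarrow> bollobas_riordan (Suc m);
       i \<leftarrow> attachment (Suc (Suc m)) G;
       return_pmf (insert (Suc (Suc m), i) G)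
     }"

definition expected_second_degree_count :: "nat \<Rightarrow> nat \<Rightarrow> real" where
  "expected_second_degree_count n k =
     measure_pmf.expectation (bollobas_riordan n)
       (\<lambda>G. real (card {t \<in> {1..n}. second_degree G t = k}))"

text \<open>Every vertex emits exactly one edge, to an earlier vertex or to itself.\<close>
definition recursive_graph :: "nat \<Rightarrow> graph \<Rightarrow> bool" where
  "recursive_graph n G \<longleftrightarrow> bij_betw fst G {1..n} \<and> (\<forall>e \<in> G. 1 \<le> snd e \<and> snd e \<le> fst e)"

lemma recursive_graph_finite: "recursive_graph n G \<Longrightarrow> finite G"
  unfolding recursive_graph_def using bij_betw_finite by blast

lemma sum_vertex_degree:
  assumes "recursive_graph n G"
  shows "(\<Sum>v = 1..n. vertex_degree G v) = 2 * n"
proof -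
  have fin: "finite G" and cardG: "card G = n"
    using recursive_graph_finite[OF assms] assms bij_betw_same_card[of fst G "{1..n}"]
    by (auto simp: recursive_graph_def)
  have b: "fst e \<in> {1..n}" "snd e \<in> {1..n}" if "e \<in> G" for e
  proof -
    show f: "fst e \<in> {1..n}"
      using assms that unfolding recursive_graph_def by (meson bij_betwE)
    show "snd e \<in> {1..n}"
      using assms that f unfolding recursive_graph_def by fastforce
  qed
  have "(\<Sum>v = 1..n. card {e \<in> G. h e = v}) = card G" if "h ` G \<subseteq> {1..n}" for h :: "nat \<times> nat \<Rightarrow> nat"
    using sum.group[OF fin _ that, of "\<lambda>_. 1::nat"] by simp
  from this[of fst] this[of snd] show ?thesis
    using b cardG by (auto simp: vertex_degree_def sum.distrib image_subset_iff)
qed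

lemma pmf_attachment:
  assumes "recursive_graph (t - 1) G" "t \<ge> 1"
  shows "pmf (attachment t G) s =
    (if 1 \<le> s \<and> s < t then real (vertex_degree G s) / (2 * real t - 1)
     else if s = t then 1 / (2 * real t - 1) else 0)"
proof -
  let ?w = "\<lambda>s. if 1 \<le> s \<and> s < t then real (vertex_degree G s) / (2 * real t - 1)
     else if s = t then 1 / (2 * real t - 1) else 0"
  have nonneg: "?w s \<ge> 0" for s using assms(2) by auto
  have int: "{1..t} = insert t {1..t - 1}" using assms(2) by auto
  have "(\<Sum>s = 1..t. ?w s) = ?w t + (\<Sum>s = 1..t - 1. ?w s)"
    unfolding int using assms(2) by (subst sum.insert) auto
  also have "(\<Sum>s = 1..t - 1. ?w s) = (\<Sum>s = 1..t - 1. real (vertex_degree G s) / (2 * real t - 1))"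
    using assms(2) by (intro sum.cong) auto
  also have "\<dots> = real (\<Sum>s = 1..t - 1. vertex_degree G s) / (2 * real t - 1)"
    by (simp add: sum_divide_distrib)
  also have "(\<Sum>s = 1..t - 1. vertex_degree G s) = 2 * (t - 1)" by (rule sum_vertex_degree[OF assms(1)])
  also have "?w t + real (2 * (t - 1)) / (2 * real t - 1) = 1"
    using assms(2) by (simp add: of_nat_diff divide_simps)
  finally have sum1: "(\<Sum>s = 1..t. ?w s) = 1" .
  have "(\<integral>\<^sup>+ s. ennreal (?w s) \<partial>count_space UNIV) = (\<Sum>s = 1..t. ennreal (?w s))"
    by (rule nn_integral_count_space'[where A = "{1..t}"]) (use assms(2) in \<open>auto split: if_splits\<close>)
  also have "\<dots> = ennreal (\<Sum>s = 1..t. ?w s)"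
    using nonneg by (rule sum_ennreal)
  also have "\<dots> = 1" unfolding sum1 by simp
  finally show ?thesis
    unfolding attachment_def using nonneg by (subst pmf_embed_pmf) auto
qed

lemma recursive_graph_bollobas_riordan:
  assumes "G \<in> set_pmf (bollobas_riordan n)"
  shows "recursive_graph n G"
  using assms
proof (induction n arbitrary: G rule: bollobas_riordan.induct)
  case (3 m)
  then obtain H i where H: "H \<in> set_pmf (bollobas_riordan (Suc m))"
    and i: "i \<in> set_pmf (attachment (Suc (Suc m)) H)" and G: "G = insert (Suc (Suc m), i) H"
    by auto
  have rec: "recursive_graph (Suc m) H" using "3.IH" H by blast
  have "1 \<le> i \<and> i \<le> Suc (Suc m)"
    using i pmf_attachment[of "Suc (Suc m)" H i] rec by (auto simp: set_pmf_iff split: if_splits)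
  moreover have "bij_betw fst G {1..Suc (Suc m)}"
  proof -
    have "bij_betw fst H {1..Suc m}" using rec by (simp add: recursive_graph_def)
    then have inj: "inj_on fst H" and img: "fst ` H = {1..Suc m}" by (auto simp: bij_betw_def)
    have "Suc (Suc m) \<notin> fst ` H" unfolding img by simp
    then have "Suc (Suc m) \<notin> fst ` (H - {(Suc (Suc m), i)})" by blast
    then have "inj_on fst G" unfolding G using inj by (simp only: inj_on_insert fst_conv) blast
    moreover have "fst ` G = {1..Suc (Suc m)}"
      unfolding G image_insert img fst_conv by auto
    ultimately show ?thesis by (simp add: bij_betw_def)
  qed
  ultimately show ?case using rec by (auto simp: recursive_graph_def G)
qed (auto simp: recursive_graph_def bij_betw_def)

lemma second_degree_altdef:
  assumes "recursive_graph n G"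
  shows "second_degree G t = (\<Sum>i | i \<noteq> t \<and> adjacent G i t. vertex_degree G i - 1)"
proof -
  define N where "N = {i. i \<noteq> t \<and> adjacent G i t}"
  define A where "A = {e \<in> G. fst e \<noteq> t \<and> snd e \<noteq> t}"
  have fin: "finite G" using assms by (rule recursive_graph_finite)
  have inj: "inj_on fst G" and le': "\<forall>e\<in>G. snd e \<le> fst e"
    using assms by (auto simp: recursive_graph_def bij_betw_def)
  have le: "b \<le> a" if "(a, b) \<in> G" for a b
    using bspec[OF le' that] by simp
  have uniq: "b = c" if "(a, b) \<in> G" "(a, c) \<in> G" for a b c
    using inj_onD[OF inj _ that] by simp
  have finA: "finite A" using fin by (simp add: A_def)
  have "N \<subseteq> fst ` G \<union> snd ` G" by (force simp: N_def adjacent_def)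
  then have finN: "finite N" using fin by (meson finite_UnI finite_imageI finite_subset)
  have deg: "vertex_degree G i - 1 = card {e \<in> A. fst e = i} + card {e \<in> A. snd e = i}" if "i \<in> N" for i
  proof -
    have it: "i \<noteq> t" "(i, t) \<in> G \<or> (t, i) \<in> G" using that by (auto simp: N_def adjacent_def)
    have one: "\<not> ((i, t) \<in> G \<and> (t, i) \<in> G)" using le it by (meson le_antisym)
    have "{e \<in> G. fst e = i} = {e \<in> A. fst e = i} \<union> ({(i, t)} \<inter> G)"
      using it by (auto simp: A_def)
    moreover have "{e \<in> G. snd e = i} = {e \<in> A. snd e = i} \<union> ({(t, i)} \<inter> G)"
      using it by (auto simp: A_def)
    moreover have "card ({e \<in> A. fst e = i} \<union> ({(i, t)} \<inter> G)) =
        card {e \<in> A. fst e = i} + card ({(i, t)} \<inter> G)"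
      using fin by (intro card_Un_disjoint) (auto simp: A_def)
    moreover have "card ({e \<in> A. snd e = i} \<union> ({(t, i)} \<inter> G)) =
        card {e \<in> A. snd e = i} + card ({(t, i)} \<inter> G)"
      using fin by (intro card_Un_disjoint) (auto simp: A_def)
    moreover have "card ({(i, t)} \<inter> G) + card ({(t, i)} \<inter> G) = 1"
      using it one by auto
    ultimately show ?thesis by (simp add: vertex_degree_def)
  qed
  have grp: "(\<Sum>i\<in>N. card {e \<in> A. h e = i}) = (\<Sum>e\<in>A. if h e \<in> N then 1 else 0)"
    for h :: "nat \<times> nat \<Rightarrow> nat"
  proof -
    have "(\<Sum>i\<in>N. card {e \<in> A. h e = i}) = (\<Sum>i\<in>N. \<Sum>e\<in>A. if h e = i then 1 else 0)"
      by (simp only: card_eq_sum sum.inter_filter[OF finA])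
    also have "\<dots> = (\<Sum>e\<in>A. \<Sum>i\<in>N. if h e = i then 1 else 0)" by (rule sum.swap)
    finally show ?thesis using finN by simp
  qed
  have notri: False if "(a, b) \<in> A" "a \<in> N" "b \<in> N" "a \<noteq> b" for a b
  proof -
    have ab: "(a, b) \<in> G" "a \<noteq> t" "b \<noteq> t" using that by (auto simp: A_def)
    have at: "(a, t) \<in> G \<or> (t, a) \<in> G" and bt: "(b, t) \<in> G \<or> (t, b) \<in> G"
      using that by (auto simp: N_def adjacent_def)
    have "(t, a) \<in> G" using at uniq[OF ab(1), of t] ab(3) by blast
    moreover have "(b, t) \<in> G" using bt uniq[OF \<open>(t, a) \<in> G\<close>, of b] that(4) by blast
    ultimately have "(t, a) \<in> G" "(b, t) \<in> G" by blast+
    then show False using le[OF \<open>(t, a) \<in> G\<close>] le[OF \<open>(b, t) \<in> G\<close>] le[OF ab(1)] that(4) by simp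
  qed
  have "(\<Sum>i\<in>N. vertex_degree G i - 1) =
      (\<Sum>e\<in>A. (if fst e \<in> N then 1 else 0) + (if snd e \<in> N then 1 else 0))"
    using deg by (simp add: sum.distrib grp)
  also have "\<dots> = (\<Sum>e\<in>A. if fst e \<in> N \<or> snd e \<in> N then (if fst e = snd e then 2 else 1) else 0)"
    by (intro sum.cong) (auto intro: ccontr dest: notri)
  also have "\<dots> = (\<Sum>e\<in>{e \<in> A. fst e \<in> N \<or> snd e \<in> N}. if fst e = snd e then 2 else 1)"
    by (rule sum.inter_filter[OF finA, symmetric])
  also have "{e \<in> A. fst e \<in> N \<or> snd e \<in> N} =
      {(a, b) \<in> G. a \<noteq> t \<and> b \<noteq> t \<and> (adjacent G a t \<or> adjacent G b t)}"
    by (auto simp: A_def N_def)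
  finally show ?thesis
    unfolding second_degree_def N_def by (simp add: case_prod_unfold)
qed

end

theory Submission
  imports Defs
begin

text \<open>
  Describe a vertex by whether it carries a loop, by its number \<open>l\<close> of neighbours and by its second
  degree \<open>k\<close>. When the vertex \<open>t\<close> arrives, a loopless vertex moves from \<open>(l, k)\<close> to \<open>(l + 1, k)\<close> with
  probability \<open>l / (2t - 1)\<close> and to \<open>(l, k + 1)\<close> with probability \<open>(l + k) / (2t - 1)\<close>, since the
  degrees of its neighbours add up to \<open>l + k\<close>; the new vertex starts in \<open>(1, d)\<close>, where \<open>d\<close> is the
  degree of its target. Hence the expected number of loopless vertices in state \<open>(l, k)\<close> is
  \<open>c(l, k) (n + 1/2)\<close>, with \<open>c\<close> the stationary solution of the recurrence, up to a deviation dominated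
  by a time-independent supersolution whose sum over \<open>l\<close> is at most \<open>2\<close>. A supersolution also shows
  that on average only \<open>O(1)\<close> looped vertices have second degree \<open>k\<close>, so the expected count is
  \<open>n \<Sum>\<^sub>l c(l, k) + O(1)\<close>.

  Summing the stationarity equation against the weights \<open>l(l + 1)\<close>, \<open>l\<close> and \<open>1\<close> gives, in this order,
  \<open>\<Sum>\<^sub>l l\<^sup>2 c(l, k) = O(1/k)\<close>, \<open>\<Sum>\<^sub>l l c(l, k) = O(ln k / k\<^sup>2)\<close> and
  \<open>\<Sum>\<^sub>l c(l, k) = 4/k\<^sup>2 + O(ln\<^sup>2 k / k\<^sup>3)\<close>.
\<close>

section \<open>Stationary solutions\<close>

text \<open>The unnormalised rate of entering \<open>(l, k)\<close>: from \<open>(l - 1, k)\<close>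
  by an edge to the vertex itself, whose degree is \<open>l - 1 + b\<close>, and from
  \<open>(l, k - 1)\<close> by an edge to a neighbour, the neighbours having total degree
  \<open>l + k - 1\<close>.\<close>

definition inflow :: "nat \<Rightarrow> (nat \<Rightarrow> nat \<Rightarrow> real) \<Rightarrow> nat \<Rightarrow> nat \<Rightarrow> real" where
  "inflow b u l k = (if l = 0 then 0 else real (l - 1 + b) * u (l - 1) k)
     + (if k = 0 then 0 else real (l + k - 1) * u l (k - 1))"

lemma inflow_mono: "(\<And>l k. u l k \<le> w l k) \<Longrightarrow> inflow b u l k \<le> inflow b w l k"
  by (auto simp: inflow_def intro!: add_mono mult_left_mono)

lemma inflow_diff_scaled:
  "inflow b u l k - x * inflow b w l k = inflow b (\<lambda>l k. u l k - x * w l k) l k"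
  by (auto simp: inflow_def algebra_simps)

lemma abs_inflow_le: "\<bar>inflow b u l k\<bar> \<le> inflow b (\<lambda>l k. \<bar>u l k\<bar>) l k"
  by (auto simp: inflow_def abs_mult intro!: order.trans[OF abs_triangle_ineq])

text \<open>Shifting \<open>l\<close> turns the weight into \<open>w (Suc l)\<close> and drops the
  index \<open>L\<close>. For nonnegative solutions adding it back gives upper bounds uniform in
  \<open>L\<close>, so no convergence has to be known beforehand.\<close>

lemma weighted_sum_inflow:
  "(\<Sum>l\<le>L. w l * inflow b u l (Suc k)) =
     (\<Sum>l<L. w (Suc l) * real (l + b) * u l (Suc k)) + (\<Sum>l\<le>L. w l * real (l + k) * u l k)"
proof -
  have "(\<Sum>l\<le>L. w l * (if l = 0 then 0 else real (l - 1 + b) * u (l - 1) (Suc k))) =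
      (\<Sum>l<L. w (Suc l) * real (l + b) * u l (Suc k))"
    by (subst sum.atMost_shift) (simp add: mult.assoc)
  then show ?thesis
    by (simp only: inflow_def distrib_left sum.distrib) (simp add: mult.assoc)
qed

lemma weighted_sum_inflow_0:
  "(\<Sum>l\<le>L. w l * inflow b u l 0) = (\<Sum>l<L. w (Suc l) * real (l + b) * u l 0)"
  by (subst sum.atMost_shift) (simp add: inflow_def mult.assoc)

text \<open>
  The solution \<open>u\<close> of \<open>(2l + k + b + e) u(l, k) = inflow b u l k + s l k\<close>. Here \<open>b\<close> is the contribution
  of a loop to the degree of the vertex, and \<open>e = 2\<close> accounts for a linear growth in time while
  \<open>e = 0\<close> gives bounds that are constant in time. For \<open>l = k = b = e = 0\<close> the division by zero
  yields 0.
\<close>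
function balance :: "nat \<Rightarrow> nat \<Rightarrow> (nat \<Rightarrow> nat \<Rightarrow> real) \<Rightarrow> nat \<Rightarrow> nat \<Rightarrow> real" where
  "balance e b s l k =
     ((if l = 0 then 0 else real (l - 1 + b) * balance e b s (l - 1) k)
       + (if k = 0 then 0 else real (l + k - 1) * balance e b s l (k - 1)) + s l k)
     / real (2 * l + k + b + e)"
  by auto
termination by (relation "Wellfounded.measure (\<lambda>(e :: nat, b :: nat, s :: nat \<Rightarrow> nat \<Rightarrow> real, l, k). l + k)") auto

declare balance.simps [simp del]

lemma balance_eq:
  assumes "2 * l + k + b + e > 0 \<or> s l k = 0"
  shows "real (2 * l + k + b + e) * balance e b s l k = inflow b (balance e b s) l k + s l k"
  by (subst balance.simps) (use assms in \<open>auto simp: inflow_def\<close>)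

lemma balance_nonneg:
  assumes "\<And>l k. s l k \<ge> 0"
  shows "balance e b s l k \<ge> 0"
proof (induction "l + k" arbitrary: l k rule: less_induct)
  case less
  have "l = 0 \<or> balance e b s (l - 1) k \<ge> 0" "k = 0 \<or> balance e b s l (k - 1) \<ge> 0"
    using less[of "l - 1" k] less[of l "k - 1"] by (cases l; cases k; simp)+
  then show ?case
    by (subst balance.simps) (use assms in \<open>auto intro!: divide_nonneg_nonneg add_nonneg_nonneg mult_nonneg_nonneg\<close>)
qed

text \<open>The source is \<open>k\<close> times the limiting density
  \<open>4 / (k (k + 1) (k + 2))\<close> of vertices of degree \<open>k\<close>: a new vertex enters
  \<open>(1, k)\<close> when its edge hits one of these, each having weight
  \<open>k\<close>.\<close>

definition limit_density :: "nat \<Rightarrow> nat \<Rightarrow> real" where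
  "limit_density = balance 2 0 (\<lambda>l k. if l = 1 \<and> k \<ge> 1 then 4 / (real (k + 1) * real (k + 2)) else 0)"

text \<open>The source 2 dominates \<open>k\<close> times the deviation of the expected number of
  vertices of degree \<open>k\<close> from its linear term, see
  \<open>expected_degree_count_deviation\<close>.\<close>

definition deviation_bound :: "nat \<Rightarrow> nat \<Rightarrow> real" where
  "deviation_bound = balance 0 0 (\<lambda>l k. if l = 1 \<and> k \<ge> 1 then 2 else 0)"

text \<open>Loops are created with weight 1, always in the state \<open>(0, 0)\<close>.\<close>

definition loop_bound :: "nat \<Rightarrow> nat \<Rightarrow> real" where
  "loop_bound = balance 0 2 (\<lambda>l k. if l = 0 \<and> k = 0 then 1 else 0)"

section \<open>Equations, signs and comparison of the three solutions\<close>

lemma limit_density_eq: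
  "real (2 * l + k + 2) * limit_density l k = inflow 0 limit_density l k +
     (if l = 1 \<and> k \<ge> 1 then 4 / (real (k + 1) * real (k + 2)) else 0)"
  unfolding limit_density_def by (subst balance_eq[symmetric]) auto

lemma deviation_bound_eq:
  "real (2 * l + k) * deviation_bound l k = inflow 0 deviation_bound l k + (if l = 1 \<and> k \<ge> 1 then 2 else 0)"
  unfolding deviation_bound_def by (subst balance_eq[symmetric]) auto

lemma loop_bound_eq:
  "real (2 * l + k + 2) * loop_bound l k = inflow 2 loop_bound l k + (if l = 0 \<and> k = 0 then 1 else 0)"
  unfolding loop_bound_def by (subst balance_eq[symmetric]) auto

lemma limit_density_nonneg: "limit_density l k \<ge> 0"
  unfolding limit_density_def by (rule balance_nonneg) auto

lemma deviation_bound_nonneg: "deviation_bound l k \<ge> 0"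
  unfolding deviation_bound_def by (rule balance_nonneg) auto

lemma loop_bound_nonneg: "loop_bound l k \<ge> 0"
  unfolding loop_bound_def by (rule balance_nonneg) auto

text \<open>The source lives on positive \<open>l\<close> and \<open>k\<close>, and inflow into
  either axis comes only from the same axis.\<close>

lemma limit_density_eq_0: "l = 0 \<or> k = 0 \<Longrightarrow> limit_density l k = 0"
proof (induction "l + k" arbitrary: l k rule: less_induct)
  case less
  have "inflow 0 limit_density l k = 0"
    using less by (auto simp: inflow_def)
  moreover have "(if l = 1 \<and> k \<ge> 1 then 4 / (real (k + 1) * real (k + 2)) else 0) = 0"
    using less.prems by auto
  ultimately have "real (2 * l + k + 2) * limit_density l k = 0"
    using limit_density_eq[of l k] by linarith
  then show ?case by simp
qed

text \<open>
  This covers the states that cannot occur yet at time \<open>n\<close>, where the deviation is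
  \<open>(n + 1/2) limit_density l k\<close>.
\<close>
lemma limit_density_le_deviation_bound:
  "limit_density l k * real (2 * l + k + 2) / 2 \<le> deviation_bound l k"
proof (induction "l + k" arbitrary: l k rule: less_induct)
  case less
  show ?case
  proof (cases "l = 0 \<or> k = 0")
    case True
    then show ?thesis using limit_density_eq_0[OF True] deviation_bound_nonneg by simp
  next
    case False
    define h where "h = real (2 * l + k)"
    have h: "h > 0" using False by (simp add: h_def)
    have c: "limit_density l k \<ge> 0" for l k by (rule limit_density_nonneg)
    \<comment> \<open>The factor \<open>2l + k + 2\<close> of the claim equals \<open>h\<close> at
      \<open>(l - 1, k)\<close> and \<open>h + 1\<close> at \<open>(l, k - 1)\<close>, so
      \<open>h / 2\<close> serves both predecessors.\<close>
    have 1: "deviation_bound (l - 1) k \<ge> limit_density (l - 1) k * (h / 2)"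
      using less[of "l - 1" k] False by (simp add: h_def of_nat_diff algebra_simps)
    have "deviation_bound l (k - 1) \<ge> limit_density l (k - 1) * ((h + 1) / 2)"
      using less[of l "k - 1"] False by (simp add: h_def of_nat_diff algebra_simps)
    then have 2: "deviation_bound l (k - 1) \<ge> limit_density l (k - 1) * (h / 2)"
      using mult_left_mono[OF _ c, of "h / 2" "(h + 1) / 2" l "k - 1"] by simp
    have "h / 2 * inflow 0 limit_density l k \<le> inflow 0 deviation_bound l k"
    proof -
      have "real (l - 1) * (limit_density (l - 1) k * (h / 2)) + real (l + k - 1) * (limit_density l (k - 1) * (h / 2))
        \<le> real (l - 1) * deviation_bound (l - 1) k + real (l + k - 1) * deviation_bound l (k - 1)"
        using 1 2 by (intro add_mono mult_left_mono) auto
      moreover have "inflow 0 u l k = real (l - 1) * u (l - 1) k + real (l + k - 1) * u l (k - 1)" for u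
        using False by (simp add: inflow_def)
      ultimately show ?thesis by (simp only: distrib_left) (simp only: mult_ac)
    qed
    \<comment> \<open>For \<open>l = 1\<close> one has \<open>h = k + 2\<close>, so the left side is
      \<open>2 / (k + 1)\<close>.\<close>
    moreover have "h / 2 * (if l = 1 \<and> k \<ge> 1 then 4 / (real (k + 1) * real (k + 2)) else 0)
        \<le> (if l = 1 \<and> k \<ge> 1 then 2 else 0)"
      by (auto simp: h_def divide_simps) (auto simp: algebra_simps)
    ultimately have "h / 2 * (real (2 * l + k + 2) * limit_density l k) \<le> h * deviation_bound l k"
      unfolding limit_density_eq h_def using deviation_bound_eq[of l k] by (simp add: distrib_left h_def)
    then have "h * (limit_density l k * real (2 * l + k + 2) / 2) \<le> h * deviation_bound l k"
      by (simp add: mult_ac)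
    then show ?thesis using h by (rule mult_left_le_imp_le)
  qed
qed

text \<open>Write \<open>2l + k = l + (l + k)\<close>. Summed over \<open>l\<close>, the first part
  cancels against the inflow along \<open>l\<close>; the second is the flux in the direction of
  \<open>k\<close>, which therefore grows by at most the source 2 per step.\<close>

lemma sum_deviation_bound_flux: "(\<Sum>l\<le>L. real (l + k) * deviation_bound l k) \<le> 2 * real k"
proof (induction k)
  case 0
  have "(\<Sum>l\<le>L. real (2 * l) * deviation_bound l 0) = (\<Sum>l<L. real l * deviation_bound l 0)"
    using weighted_sum_inflow_0[of "\<lambda>_. 1" 0 deviation_bound L] deviation_bound_eq[of _ 0] by simp
  also have "\<dots> \<le> (\<Sum>l\<le>L. real l * deviation_bound l 0)"
    by (intro sum_mono2) (auto simp: deviation_bound_nonneg)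
  finally show ?case by (simp add: sum_distrib_left[symmetric] mult.assoc)
next
  case (Suc k)
  have "(\<Sum>l\<le>L. real (2 * l + Suc k) * deviation_bound l (Suc k)) =
      (\<Sum>l<L. real l * deviation_bound l (Suc k)) + (\<Sum>l\<le>L. real (l + k) * deviation_bound l k)
        + (\<Sum>l\<le>L. if l = 1 then 2 else 0)"
    using weighted_sum_inflow[of "\<lambda>_. 1" 0 deviation_bound k L] 
    by (simp only: deviation_bound_eq sum.distrib) simp
  moreover have "(\<Sum>l\<le>L. if l = 1 then 2 else 0 :: real) \<le> 2" by simp
  moreover have "(\<Sum>l<L. real l * deviation_bound l (Suc k)) \<le> (\<Sum>l\<le>L. real l * deviation_bound l (Suc k))"
    by (intro sum_mono2) (auto simp: deviation_bound_nonneg)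
  moreover have "(\<Sum>l\<le>L. real (2 * l + Suc k) * deviation_bound l (Suc k)) =
      (\<Sum>l\<le>L. real l * deviation_bound l (Suc k)) + (\<Sum>l\<le>L. real (l + Suc k) * deviation_bound l (Suc k))"
    by (simp add: sum.distrib[symmetric] algebra_simps)
  ultimately show ?case using Suc by simp
qed

text \<open>The same splitting, now \<open>2l + k + 2 = (l + 2) + (l + k)\<close>. The only source
  sits at \<open>(0, 0)\<close>, so the flux in \<open>k\<close> never exceeds its strength
  1.\<close>

lemma sum_loop_bound_flux: "(\<Sum>l\<le>L. real (l + k) * loop_bound l k) \<le> 1"
proof (induction k)
  case 0
  have "(\<Sum>l\<le>L. real (2 * l + 2) * loop_bound l 0) = (\<Sum>l<L. real (l + 2) * loop_bound l 0) + 1"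
    using weighted_sum_inflow_0[of "\<lambda>_. 1" 2 loop_bound L]  loop_bound_eq[of _ 0] by (simp add: sum.distrib)
  also have "(\<Sum>l<L. real (l + 2) * loop_bound l 0) \<le> (\<Sum>l\<le>L. real (l + 2) * loop_bound l 0)"
    by (intro sum_mono2) (auto simp: loop_bound_nonneg)
  finally have "(\<Sum>l\<le>L. real (2 * l + 2) * loop_bound l 0) - (\<Sum>l\<le>L. real (l + 2) * loop_bound l 0) \<le> 1"
    by simp
  then show ?case by (simp add: sum_subtractf[symmetric] left_diff_distrib[symmetric])
next
  case (Suc k)
  have "(\<Sum>l\<le>L. real (2 * l + Suc k + 2) * loop_bound l (Suc k)) =
      (\<Sum>l<L. real (l + 2) * loop_bound l (Suc k)) + (\<Sum>l\<le>L. real (l + k) * loop_bound l k)"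
    using weighted_sum_inflow[of "\<lambda>_. 1" 2 loop_bound k L] by (simp only: loop_bound_eq sum.distrib) simp
  moreover have "(\<Sum>l<L. real (l + 2) * loop_bound l (Suc k)) \<le> (\<Sum>l\<le>L. real (l + 2) * loop_bound l (Suc k))"
    by (intro sum_mono2) (auto simp: loop_bound_nonneg)
  moreover have "(\<Sum>l\<le>L. real (2 * l + Suc k + 2) * loop_bound l (Suc k)) =
      (\<Sum>l\<le>L. real (l + 2) * loop_bound l (Suc k)) + (\<Sum>l\<le>L. real (l + Suc k) * loop_bound l (Suc k))"
    by (simp add: sum.distrib[symmetric] algebra_simps)
  ultimately show ?case using Suc by simp
qed

lemma sum_deviation_bound: "k \<ge> 1 \<Longrightarrow> (\<Sum>l\<le>L. deviation_bound l k) \<le> 2"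
proof -
  assume k: "k \<ge> 1"
  have "real k * (\<Sum>l\<le>L. deviation_bound l k) \<le> (\<Sum>l\<le>L. real (l + k) * deviation_bound l k)"
    unfolding sum_distrib_left by (intro sum_mono mult_right_mono) (auto simp: deviation_bound_nonneg)
  also have "\<dots> \<le> real k * 2" using sum_deviation_bound_flux[where L = L and k = k] by simp
  finally show ?thesis using k by simp
qed

lemma sum_loop_bound: "k \<ge> 1 \<Longrightarrow> (\<Sum>l\<le>L. loop_bound l k) \<le> 1"
proof -
  assume k: "k \<ge> 1"
  have "(\<Sum>l\<le>L. loop_bound l k) \<le> (\<Sum>l\<le>L. real (l + k) * loop_bound l k)"
  proof (intro sum_mono)
    fix l show "loop_bound l k \<le> real (l + k) * loop_bound l k"
      using k mult_right_mono[of 1 "real (l + k)" "loop_bound l k"] loop_bound_nonneg by simp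
  qed
  then show ?thesis using sum_loop_bound_flux[where L = L and k = k] by simp
qed

text \<open>Since \<open>w l = l (l + 1)\<close> satisfies \<open>l w(l + 1) = (l + 2) w l\<close>, this sum grows with \<open>k\<close> only by the source term.\<close>
lemma third_moment_bound:
  "(\<Sum>l\<le>L. real (l * (l + 1)) * real (l + k) * limit_density l k) \<le> 4 - 8 / real (k + 2)"
proof (induction k)
  case 0
  show ?case by (simp add: limit_density_eq_0)
next
  case (Suc k)
  define w where "w l = real (l * (l + 1))" for l
  define c where "c = limit_density"
  have c: "c l k \<ge> 0" for l k by (simp add: c_def limit_density_nonneg)
  have w: "w l \<ge> 0" for l by (simp add: w_def)
  have "(\<Sum>l\<le>L. w l * (real (2 * l + Suc k + 2) * c l (Suc k))) =
      (\<Sum>l\<le>L. w l * inflow 0 c l (Suc k)) + (\<Sum>l\<le>L. if l = 1 then 8 / (real (k + 2) * real (k + 3)) else 0)"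
    unfolding c_def limit_density_eq sum.distrib[symmetric]
    by (intro sum.cong refl) (auto simp: w_def algebra_simps)
  moreover have "(\<Sum>l\<le>L. if l = 1 then 8 / (real (k + 2) * real (k + 3)) else 0) \<le> 8 / (real (k + 2) * real (k + 3))"
    by simp
  moreover have "(\<Sum>l\<le>L. w l * inflow 0 c l (Suc k)) =
      (\<Sum>l<L. w l * real (l + 2) * c l (Suc k)) + (\<Sum>l\<le>L. w l * real (l + k) * c l k)"
    unfolding weighted_sum_inflow by (auto intro!: sum.cong simp: w_def algebra_simps)
  moreover have "(\<Sum>l<L. w l * real (l + 2) * c l (Suc k)) \<le> (\<Sum>l\<le>L. w l * real (l + 2) * c l (Suc k))"
    by (intro sum_mono2) (auto simp: c w)
  moreover have "(\<Sum>l\<le>L. w l * (real (2 * l + Suc k + 2) * c l (Suc k))) =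
      (\<Sum>l\<le>L. w l * real (l + 2) * c l (Suc k)) + (\<Sum>l\<le>L. w l * real (l + Suc k) * c l (Suc k))"
    by (simp add: sum.distrib[symmetric] algebra_simps)
  \<comment> \<open>Telescoping the source gives the bound its form, with value 0 at
    \<open>k = 0\<close>.\<close>
  moreover have "8 / (real (k + 2) * real (k + 3)) = 8 / real (k + 2) - 8 / real (k + 3)"
    by (simp add: field_simps)
  ultimately show ?case using Suc unfolding w_def[symmetric] c_def[symmetric]
    by (simp add: add.commute)
qed

section \<open>Moments of the limit density\<close>

text \<open>For \<open>l >= 1\<close> the power is at most \<open>l ^ 3\<close>, hence below the
  weight of \<open>third_moment_bound\<close>. At \<open>l = 0\<close> the density vanishes, which
  matters because \<open>0 ^ 0 = 1\<close>.\<close>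

lemma summable_limit_density_moment:
  assumes "j \<le> 3"
  shows "summable (\<lambda>l. real l ^ j * limit_density l k)"
proof -
  have "summable (\<lambda>l. real (l * (l + 1)) * real (l + k) * limit_density l k)"
  proof (rule bounded_imp_summable)
    show "(\<Sum>l\<le>L. real (l * (l + 1)) * real (l + k) * limit_density l k) \<le> 4" for L
      using third_moment_bound[of k L] by (rule order.trans) simp
  qed (simp add: limit_density_nonneg)
  then show ?thesis
  proof (rule summable_comparison_test_ev[rotated])
    have "norm (real l ^ j * limit_density l k) \<le> real (l * (l + 1)) * real (l + k) * limit_density l k" for l
    proof (cases "l = 0")
      case False
      then have "real l ^ j \<le> real l ^ 3" using assms by (intro power_increasing) auto
      also have "\<dots> \<le> real (l * (l + 1)) * real (l + k)"
        unfolding power3_eq_cube of_nat_mult by (intro mult_mono) auto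
      finally show ?thesis by (simp add: limit_density_nonneg mult_right_mono)
    qed (simp add: limit_density_eq_0)
    then show "\<forall>\<^sub>F l in sequentially. norm (real l ^ j * limit_density l k)
        \<le> real (l * (l + 1)) * real (l + k) * limit_density l k" by simp
  qed
qed

definition moment :: "nat \<Rightarrow> nat \<Rightarrow> real" where
  "moment j k = (\<Sum>l. real l ^ j * limit_density l k)"

lemma sums_moment: "j \<le> 3 \<Longrightarrow> (\<lambda>l. real l ^ j * limit_density l k) sums moment j k"
  unfolding moment_def by (rule summable_sums[OF summable_limit_density_moment])

lemma moment_nonneg: "j \<le> 3 \<Longrightarrow> moment j k \<ge> 0"
  unfolding moment_def by (intro suminf_nonneg summable_limit_density_moment) (auto simp: limit_density_nonneg)

lemma moment_0_right: "moment j 0 = 0"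
  by (simp add: moment_def limit_density_eq_0)

lemma second_moment_le:
  assumes "k \<ge> 1"
  shows "real k * moment 2 k \<le> 4"
proof -
  have "(\<lambda>l. real k * (real l ^ 2 * limit_density l k)) sums (real k * moment 2 k)"
    by (intro sums_mult sums_moment) simp
  then have "(\<lambda>L. \<Sum>l\<le>L. real k * (real l ^ 2 * limit_density l k)) \<longlonglongrightarrow> real k * moment 2 k"
    by (simp add: sums_def_le)
  moreover have "(\<Sum>l\<le>L. real k * (real l ^ 2 * limit_density l k)) \<le> 4" for L
  proof -
    have "(\<Sum>l\<le>L. real k * (real l ^ 2 * limit_density l k)) \<le>
        (\<Sum>l\<le>L. real (l * (l + 1)) * real (l + k) * limit_density l k)"
    proof (intro sum_mono)
      fix l
      have "real k * real l ^ 2 \<le> real (l * (l + 1)) * real (l + k)"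
        by (simp add: power2_eq_square algebra_simps)
      then show "real k * (real l ^ 2 * limit_density l k) \<le> real (l * (l + 1)) * real (l + k) * limit_density l k"
        using mult_right_mono limit_density_nonneg by (metis mult.assoc)
    qed
    also have "\<dots> \<le> 4" using third_moment_bound[of k L] by (rule order.trans) simp
    finally show ?thesis .
  qed
  ultimately show ?thesis by (intro LIMSEQ_le_const2) auto
qed

text \<open>Passing to the limit in the truncated weighted sums turns the inequalities used so far
  into identities; the weights 1 and \<open>l\<close> need only moments up to order 2.\<close>

lemma limit_flux_identity:
  assumes "(\<lambda>l. w l * real (2 * l + k + 3) * limit_density l (Suc k)) sums a"
    and "(\<lambda>l. w (Suc l) * real l * limit_density l (Suc k)) sums b"
    and "(\<lambda>l. w l * real (l + k) * limit_density l k) sums d"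
  shows "a = b + d + w 1 * (4 / (real (k + 2) * real (k + 3)))"
proof -
  define r where "r = w 1 * (4 / (real (k + 2) * real (k + 3)))"
  have "(\<lambda>L. \<Sum>l\<le>L. w l * real (2 * l + k + 3) * limit_density l (Suc k)) \<longlonglongrightarrow> a"
    using assms(1) by (simp add: sums_def_le)
  moreover have "(\<lambda>L. (\<Sum>l<L. w (Suc l) * real l * limit_density l (Suc k))
      + (\<Sum>l\<le>L. w l * real (l + k) * limit_density l k) + r) \<longlonglongrightarrow> b + d + r"
    using assms(2)[unfolded sums_def] assms(3)[unfolded sums_def_le] by (intro tendsto_intros)
  moreover have "\<forall>\<^sub>F L in sequentially. (\<Sum>l\<le>L. w l * real (2 * l + k + 3) * limit_density l (Suc k)) =
      (\<Sum>l<L. w (Suc l) * real l * limit_density l (Suc k))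
      + (\<Sum>l\<le>L. w l * real (l + k) * limit_density l k) + r"
    using eventually_ge_at_top[of 1]
  proof eventually_elim
    case (elim L)
    have "(\<Sum>l\<le>L. w l * real (2 * l + k + 3) * limit_density l (Suc k)) =
        (\<Sum>l\<le>L. w l * (real (2 * l + Suc k + 2) * limit_density l (Suc k)))"
      by (intro sum.cong) (auto simp: mult.assoc)
    also have "\<dots> = (\<Sum>l\<le>L. w l * inflow 0 limit_density l (Suc k)) + (\<Sum>l\<le>L. if l = 1 then r else 0)"
      unfolding limit_density_eq sum.distrib[symmetric]
      by (intro sum.cong refl) (auto simp: r_def algebra_simps)
    also have "(\<Sum>l\<le>L. if l = 1 then r else 0) = r" using elim by simp
    finally show ?case unfolding weighted_sum_inflow by simp
  qed
  ultimately have "(\<lambda>L. (\<Sum>l<L. w (Suc l) * real l * limit_density l (Suc k))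
      + (\<Sum>l\<le>L. w l * real (l + k) * limit_density l k) + r) \<longlonglongrightarrow> a"
    by (simp add: filterlim_cong)
  then show ?thesis
    using \<open>_ \<longlonglongrightarrow> b + d + r\<close> LIMSEQ_unique unfolding r_def by blast
qed

text \<open>The weight 1: of the outflow \<open>2l + k + 3\<close>, one \<open>l\<close> is balanced
  by the inflow along \<open>l\<close>.\<close>

lemma mass_recurrence:
  "moment 1 (Suc k) + real (k + 3) * moment 0 (Suc k) =
     moment 1 k + real k * moment 0 k + 4 / (real (k + 2) * real (k + 3))"
proof -
  have 1: "(\<lambda>l. 1 * real (2 * l + k + 3) * limit_density l (Suc k)) sums
      (2 * moment 1 (Suc k) + real (k + 3) * moment 0 (Suc k))"
    using sums_add[OF sums_mult[OF sums_moment[of 1 "Suc k"], of 2] sums_mult[OF sums_moment[of 0 "Suc k"], of "real (k + 3)"]]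
    by (simp add: algebra_simps)
  have 2: "(\<lambda>l. 1 * real l * limit_density l (Suc k)) sums moment 1 (Suc k)"
    using sums_moment[of 1 "Suc k"] by simp
  have 3: "(\<lambda>l. 1 * real (l + k) * limit_density l k) sums (moment 1 k + real k * moment 0 k)"
    using sums_add[OF sums_moment[of 1 k] sums_mult[OF sums_moment[of 0 k], of "real k"]]
    by (simp add: algebra_simps)
  show ?thesis using limit_flux_identity[OF 1 2 3] by simp
qed

text \<open>The weight \<open>l\<close>: the inflow along \<open>l\<close> carries
  \<open>(l + 1) l\<close>, so it cancels one second and one first moment.\<close>

lemma mean_recurrence:
  "moment 2 (Suc k) + real (k + 2) * moment 1 (Suc k) =
     moment 2 k + real k * moment 1 k + 4 / (real (k + 2) * real (k + 3))"
proof -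
  have 1: "(\<lambda>l. real l * real (2 * l + k + 3) * limit_density l (Suc k)) sums
      (2 * moment 2 (Suc k) + real (k + 3) * moment 1 (Suc k))"
    using sums_add[OF sums_mult[OF sums_moment[of 2 "Suc k"], of 2] sums_mult[OF sums_moment[of 1 "Suc k"], of "real (k + 3)"]]
    by (simp add: algebra_simps power2_eq_square)
  have 2: "(\<lambda>l. real (Suc l) * real l * limit_density l (Suc k)) sums (moment 2 (Suc k) + moment 1 (Suc k))"
    using sums_add[OF sums_moment[of 2 "Suc k"] sums_moment[of 1 "Suc k"]]
    by (simp add: algebra_simps power2_eq_square)
  have 3: "(\<lambda>l. real l * real (l + k) * limit_density l k) sums (moment 2 k + real k * moment 1 k)"
    using sums_add[OF sums_moment[of 2 k] sums_mult[OF sums_moment[of 1 k], of "real k"]]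
    by (simp add: algebra_simps power2_eq_square)
  show ?thesis using limit_flux_identity[OF 1 2 3] by (simp add: algebra_simps)
qed

section \<open>Logarithmic estimates of the moments\<close>

lemma inverse_Suc_le_ln_diff: "k \<ge> 1 \<Longrightarrow> 1 / real (Suc k) \<le> ln (real (Suc k)) - ln (real k)"
proof -
  assume k: "k \<ge> 1"
  have "ln (real k / real (Suc k)) \<le> real k / real (Suc k) - 1"
    using k by (intro ln_le_minus_one) auto
  also have "\<dots> = - (1 / real (Suc k))" by (simp add: field_simps)
  finally show ?thesis using k by (simp add: ln_div)
qed

text \<open>The factor \<open>k + 1\<close> is an integrating factor for
  \<open>mean_recurrence\<close>: it makes the flux telescope up to the rescaled source and one
  second moment, each at most \<open>4 / (k + 1)\<close> on passing to \<open>Suc k\<close>. The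
  harmonic sum yields the logarithm.\<close>

lemma mean_flux_le:
  "k \<ge> 1 \<Longrightarrow> real (k + 1) * (moment 2 k + real k * moment 1 k) \<le> 8 * (1 + ln (real k))"
proof (induction k rule: nat_induct_at_least)
  case base
  show ?case
    using mean_recurrence[of 0] second_moment_le[of 1] by (simp add: moment_0_right)
next
  case (Suc k)
  define x where "x = real k"
  have x: "x \<ge> 1" using Suc by (simp add: x_def)
  define G where "G = moment 2 k + real k * moment 1 k"
  define G' where "G' = moment 2 (Suc k) + real (Suc k) * moment 1 (Suc k)"
  have "G' + moment 1 (Suc k) = G + 4 / ((x + 2) * (x + 3))"
    using mean_recurrence[of k] by (simp add: G_def G'_def x_def algebra_simps)
  then have "(x + 1) * G' + (x + 1) * moment 1 (Suc k) = (x + 1) * G + 4 * (x + 1) / ((x + 2) * (x + 3))"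
    by (metis distrib_left mult.commute mult.left_commute times_divide_eq_right)
  then have "(x + 2) * G' = (x + 1) * G + 4 * (x + 1) / ((x + 2) * (x + 3)) + moment 2 (Suc k)"
    by (simp add: G'_def x_def algebra_simps)
  moreover have "4 * (x + 1) / ((x + 2) * (x + 3)) \<le> 4 / (x + 1)"
    using x by (simp add: divide_simps) (simp add: algebra_simps)
  moreover have "moment 2 (Suc k) \<le> 4 / (x + 1)"
    using second_moment_le[of "Suc k"] x by (simp add: field_simps x_def)
  moreover have "(x + 1) * G \<le> 8 * (1 + ln x)" using Suc by (simp add: G_def x_def add.commute)
  moreover have "8 / (x + 1) \<le> 8 * (ln (x + 1) - ln x)"
    using inverse_Suc_le_ln_diff[OF Suc(1)] by (simp add: x_def add.commute field_simps)
  ultimately have "(x + 2) * G' \<le> 8 * (1 + ln (x + 1))" by simp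
  then show ?case by (simp add: G'_def x_def add_ac)
qed

lemma mean_le:
  assumes "k \<ge> 1"
  shows "moment 1 k \<le> 8 * (1 + ln (real k)) / (real k * real (k + 1))"
proof -
  have "real (k + 1) * (real k * moment 1 k) \<le> real (k + 1) * (moment 2 k + real k * moment 1 k)"
    using moment_nonneg[of 2 k] by (intro mult_left_mono) auto
  also note mean_flux_le[OF assms]
  finally have "moment 1 k * (real k * real (k + 1)) \<le> 8 * (1 + ln (real k))" by (simp only: mult_ac)
  then show ?thesis using assms by (subst pos_le_divide_eq) auto
qed

text \<open>The integrating factor of \<open>mass_recurrence\<close> is
  \<open>(k + 1) (k + 2)\<close>. Times the source it is \<open>4 + O(1/k)\<close> per step, whence
  \<open>4 k\<close>; the first moments contribute \<open>O(ln k / k)\<close> per step, whence the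
  squared logarithm.\<close>

lemma mass_flux_estimate:
  "k \<ge> 1 \<Longrightarrow> \<bar>real (k + 1) * real (k + 2) * (moment 1 k + real k * moment 0 k) - 4 * real k\<bar> \<le> 16 * (1 + ln (real k))\<^sup>2"
proof (induction k rule: nat_induct_at_least)
  case base
  have "6 * (moment 1 1 + moment 0 1) = 4 / 3 + 4 * moment 1 1"
    using mass_recurrence[of 0] by (simp add: moment_0_right)
  moreover have "moment 1 1 \<le> 4" using mean_le[of 1] by simp
  ultimately show ?case using moment_nonneg[of 1 1] by simp
next
  case (Suc k)
  define x where "x = real k"
  have x: "x \<ge> 1" using Suc by (simp add: x_def)
  define F where "F = moment 1 k + real k * moment 0 k"
  define F' where "F' = moment 1 (Suc k) + real (Suc k) * moment 0 (Suc k)"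
  define a where "a = moment 1 (Suc k)"
  define b where "b = moment 0 (Suc k)"
  have "a + (x + 3) * b = F + 4 / ((x + 2) * (x + 3))"
    using mass_recurrence[of k] by (simp add: F_def a_def b_def x_def algebra_simps)
  moreover have "(x + 1) * (x + 2) * (4 / ((x + 2) * (x + 3))) = 4 * (x + 1) / (x + 3)"
    using x by (simp add: divide_simps)
  ultimately have "(x + 1) * (x + 2) * (a + (x + 3) * b) = (x + 1) * (x + 2) * F + 4 * (x + 1) / (x + 3)"
    by (simp only: distrib_left)
  moreover have "(x + 2) * (x + 3) * (a + (x + 1) * b) = (x + 1) * (x + 2) * (a + (x + 3) * b) + 2 * (x + 2) * a"
    by (simp add: algebra_simps)
  moreover have "F' = a + (x + 1) * b" by (simp add: F'_def a_def b_def x_def algebra_simps)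
  moreover have "4 * (x + 1) / (x + 3) = 4 - 8 / (x + 3)" using x by (simp add: field_simps)
  ultimately have step: "(x + 2) * (x + 3) * F' - 4 * (x + 1) =
      ((x + 1) * (x + 2) * F - 4 * x) + (2 * (x + 2) * a - 8 / (x + 3))" by simp
  define u where "u = 1 + ln x"
  define u' where "u' = 1 + ln (x + 1)"
  have u: "u \<ge> 1" using x by (simp add: u_def)
  have uu: "1 / (x + 1) \<le> u' - u"
    using inverse_Suc_le_ln_diff[OF Suc(1)] by (simp add: x_def u_def u'_def add.commute)
  have u': "u' \<ge> 1" using x by (simp add: u'_def)
  have a0: "a \<ge> 0" unfolding a_def by (rule moment_nonneg) simp
  have "a \<le> 8 * u' / ((x + 1) * (x + 2))"
    using mean_le[of "Suc k"] by (simp add: a_def u'_def x_def add_ac)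
  then have "2 * (x + 2) * a \<le> 2 * (x + 2) * (8 * u' / ((x + 1) * (x + 2)))"
    using x by (intro mult_left_mono) auto
  also have "\<dots> = 16 * u' * (1 / (x + 1))" using x by (simp add: divide_simps)
  finally have le: "2 * (x + 2) * a \<le> 16 * u' * (1 / (x + 1))" .
  have "8 / (x + 3) \<le> 16 * 1 * (1 / (x + 1))" using x by (simp add: field_simps)
  also have "\<dots> \<le> 16 * u' * (1 / (x + 1))" using u' x by (intro mult_right_mono mult_left_mono) auto
  finally have "\<bar>2 * (x + 2) * a - 8 / (x + 3)\<bar> \<le> 16 * u' * (1 / (x + 1))"
    using le a0 x by (smt (verit) divide_nonneg_nonneg mult_nonneg_nonneg)
  also have "\<dots> \<le> 16 * u' * (u' - u)" using u' uu by (intro mult_left_mono) auto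
  \<comment> \<open>Enlarging \<open>u'\<close> to \<open>u' + u\<close> makes the increment a
    difference of squares, which telescopes.\<close>
  also have "\<dots> \<le> 16 * (u' + u) * (u' - u)"
  proof -
    have "0 \<le> 1 / (x + 1)" using x by simp
    then have "0 \<le> u' - u" using uu by linarith
    then show ?thesis using u by (intro mult_right_mono) auto
  qed
  also have "\<dots> = 16 * u'\<^sup>2 - 16 * u\<^sup>2" by (simp add: power2_eq_square algebra_simps)
  finally have "\<bar>(x + 2) * (x + 3) * F' - 4 * (x + 1)\<bar> \<le> 16 * u'\<^sup>2"
    using step Suc.IH unfolding F_def[symmetric] by (simp add: x_def u_def add_ac)
  then show ?case by (simp add: F'_def x_def u'_def add_ac)
qed

text \<open>Solve the flux for the mass: \<open>x * moment 0 k\<close> is the flux, close to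
  \<open>4 / x\<close>, minus \<open>moment 1 k\<close>, which is
  \<open>O(ln x / x ^ 2)\<close>.\<close>

lemma mass_estimate:
  assumes "k \<ge> 2"
  shows "\<bar>moment 0 k - 4 / (real k)\<^sup>2\<bar> \<le> 324 * (ln (real k))\<^sup>2 / real k ^ 3"
proof -
  define x where "x = real k"
  have x: "x \<ge> 2" using assms by (simp add: x_def)
  define u where "u = 1 + ln x"
  have u: "u \<ge> 1" using x by (simp add: u_def)
  define F where "F = moment 1 k + real k * moment 0 k"
  define R where "R = (x + 1) * (x + 2) * F"
  have R: "\<bar>R - 4 * x\<bar> \<le> 16 * u\<^sup>2"
    using mass_flux_estimate[of k] assms by (simp add: R_def F_def x_def u_def add_ac)
  have Rx: "\<bar>R - 4 * x\<bar> / ((x + 1) * (x + 2)) \<le> 16 * u\<^sup>2 / x\<^sup>2"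
    using R x by (intro frac_le) (auto simp: power2_eq_square intro!: mult_mono)
  have "\<bar>F - 4 / x\<bar> = \<bar>(R - 4 * x) / ((x + 1) * (x + 2)) - (12 * x + 8) / (x * (x + 1) * (x + 2))\<bar>"
  proof -
    have "F = R / ((x + 1) * (x + 2))" using x by (simp add: R_def)
    \<comment> \<open>The remainder \<open>12 x + 8\<close> is
      \<open>4 ((x + 1) (x + 2) - x * x)\<close>.\<close>
    moreover have "4 / x = 4 * x / ((x + 1) * (x + 2)) + (12 * x + 8) / (x * (x + 1) * (x + 2))"
      using x by (simp add: divide_simps) (simp add: algebra_simps)
    ultimately show ?thesis by (simp only: diff_divide_distrib diff_diff_eq)
  qed
  also have "\<dots> \<le> \<bar>R - 4 * x\<bar> / ((x + 1) * (x + 2)) + (12 * x + 8) / (x * (x + 1) * (x + 2))"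
    using x by (simp add: abs_mult abs_div_pos[symmetric] order.trans[OF abs_triangle_ineq4])
  also have "(12 * x + 8) / (x * (x + 1) * (x + 2)) \<le> 12 / x\<^sup>2"
  proof -
    have "(12 * x + 8) / (x * (x + 1) * (x + 2)) \<le> (12 * x + 12) / (x * (x + 1) * x)"
      using x by (intro frac_le mult_left_mono) auto
    also have "\<dots> = 12 * (x + 1) / (x\<^sup>2 * (x + 1))" by (simp add: power2_eq_square mult_ac)
    also have "\<dots> = 12 / x\<^sup>2" using x by (intro nonzero_mult_divide_mult_cancel_right) auto
    finally show ?thesis .
  qed
  finally have 1: "\<bar>F - 4 / x\<bar> \<le> 16 * u\<^sup>2 / x\<^sup>2 + 12 / x\<^sup>2" using Rx by simp
  have "moment 1 k \<le> 8 * u / (x * (x + 1))"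
    using mean_le[of k] assms by (simp add: u_def x_def add_ac)
  also have "\<dots> \<le> 8 * u / x\<^sup>2"
    using x u by (intro divide_left_mono) (auto simp: power2_eq_square)
  finally have 2: "\<bar>moment 1 k\<bar> \<le> 8 * u / x\<^sup>2" using moment_nonneg[of 1 k] by simp
  have "\<bar>x * (moment 0 k - 4 / x\<^sup>2)\<bar> = \<bar>(F - 4 / x) - moment 1 k\<bar>"
    using x by (simp add: F_def x_def[symmetric] power2_eq_square algebra_simps)
  also have "\<dots> \<le> (16 * u\<^sup>2 + 12 + 8 * u) / x\<^sup>2"
    using 1 2 by (simp add: add_divide_distrib)
  also have "\<dots> \<le> 36 * u\<^sup>2 / x\<^sup>2"
  proof -
    have "u * 1 \<le> u\<^sup>2" "1 * 1 \<le> u\<^sup>2" unfolding power2_eq_square using u by (intro mult_mono; simp)+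
    then show ?thesis using x by (intro divide_right_mono) auto
  qed
  also have "\<dots> \<le> 36 * (3 * ln x)\<^sup>2 / x\<^sup>2"
  proof -
    \<comment> \<open>Since \<open>k >= 2\<close>, one has \<open>1 <= 2 ln x\<close>; thus
      \<open>u <= 3 ln x\<close>, and \<open>324 = 36 * 9\<close>.\<close>
    have "1 / 2 \<le> ln (2 :: real)" using ln2_ge_two_thirds by simp
    also have "\<dots> \<le> ln x" using x by simp
    finally have "u \<le> 3 * ln x" by (simp add: u_def)
    then show ?thesis using u x by (intro divide_right_mono mult_left_mono power_mono) auto
  qed
  finally have "x * \<bar>moment 0 k - 4 / x\<^sup>2\<bar> \<le> 324 * (ln x)\<^sup>2 / x\<^sup>2"
    using x by (simp add: abs_mult power_mult_distrib)
  then show ?thesis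
    using x unfolding x_def[symmetric] by (simp add: field_simps power2_eq_square power3_eq_cube)
qed

section \<open>One attachment step\<close>

definition neighbours :: "graph \<Rightarrow> nat \<Rightarrow> nat set" where
  "neighbours G v = {i. i \<noteq> v \<and> adjacent G i v}"

context
  fixes m :: nat and G :: graph
  assumes rec: "recursive_graph m G"
begin

lemma recursive_edge_bounds: "(a, b) \<in> G \<Longrightarrow> 1 \<le> b \<and> b \<le> a \<and> a \<le> m"
  using rec bij_betwE[of fst G "{1..m}"] unfolding recursive_graph_def by fastforce

lemma recursive_edge_unique: "(a, b) \<in> G \<Longrightarrow> (a, c) \<in> G \<Longrightarrow> b = c"
  using rec unfolding recursive_graph_def bij_betw_def inj_on_def by fastforce

lemma neighbours_subset: "neighbours G v \<subseteq> {1..m}"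
  unfolding neighbours_def adjacent_def using recursive_edge_bounds by fastforce

lemma finite_neighbours: "finite (neighbours G v)"
  using neighbours_subset finite_subset by blast

lemma card_neighbours_le: "card (neighbours G v) \<le> m"
  using card_mono[OF _ neighbours_subset] by simp

lemma vertex_degree_alt: "vertex_degree G v = card {i. (v, i) \<in> G} + card {i. (i, v) \<in> G}"
proof -
  have "{e \<in> G. fst e = v} = Pair v ` {i. (v, i) \<in> G}" by auto
  moreover have "{e \<in> G. snd e = v} = (\<lambda>i. (i, v)) ` {i. (i, v) \<in> G}" by auto
  ultimately show ?thesis
    unfolding vertex_degree_def by (simp add: card_image inj_on_def)
qed

text \<open>Edges point to earlier vertices, so no other vertex is joined to \<open>v\<close> in
  both directions, while a loop is counted once on each side.\<close>

lemma vertex_degree_eq_neighbours: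
  "vertex_degree G v = card (neighbours G v) + (if (v, v) \<in> G then 2 else 0)"
proof -
  define A where "A = {i. i \<noteq> v \<and> (v, i) \<in> G}"
  define B where "B = {i. i \<noteq> v \<and> (i, v) \<in> G}"
  have sub: "A \<subseteq> {1..m}" "B \<subseteq> {1..m}"
    using recursive_edge_bounds unfolding A_def B_def by fastforce+
  then have fin: "finite A" "finite B" using finite_subset by blast+
  have "A \<inter> B = {}"
    using recursive_edge_bounds le_antisym unfolding A_def B_def by blast
  moreover have "neighbours G v = A \<union> B"
    by (auto simp: neighbours_def adjacent_def A_def B_def)
  ultimately have "card (neighbours G v) = card A + card B"
    using fin by (simp add: card_Un_disjoint)
  moreover have "{i. (v, i) \<in> G} = (if (v, v) \<in> G then insert v A else A)"
    "{i. (i, v) \<in> G} = (if (v, v) \<in> G then insert v B else B)"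
    by (auto simp: A_def B_def)
  moreover have "v \<notin> A" "v \<notin> B" by (auto simp: A_def B_def)
  ultimately show ?thesis using fin by (simp add: vertex_degree_alt)
qed

lemma vertex_degree_pos: "v \<in> {1..m} \<Longrightarrow> vertex_degree G v \<ge> 1"
proof -
  assume "v \<in> {1..m}"
  then obtain e where "e \<in> G" "fst e = v"
    using rec unfolding recursive_graph_def bij_betw_def by (metis imageE)
  then have "{e \<in> G. fst e = v} \<noteq> {}" by blast
  then have "card {e \<in> G. fst e = v} > 0"
    using recursive_graph_finite[OF rec] by (simp add: card_gt_0_iff)
  then show ?thesis by (simp add: vertex_degree_def)
qed

lemma vertex_degree_le: "vertex_degree G v \<le> m + 1"
proof -
  have inj: "inj_on fst G" and c: "card G = m" and fin: "finite G"
    using rec recursive_graph_finite[OF rec] bij_betw_same_card[of fst G "{1..m}"]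
    by (auto simp: recursive_graph_def bij_betw_def)
  have "finite {e \<in> G. fst e = v}" using fin by simp
  then have "card {e \<in> G. fst e = v} \<le> 1"
    using inj_onD[OF inj] by (simp add: card_le_Suc0_iff_eq)
  moreover have "card {e \<in> G. snd e = v} \<le> m"
    unfolding c[symmetric] using fin by (intro card_mono) auto
  ultimately show ?thesis by (simp add: vertex_degree_def)
qed

lemma second_degree_eq: "second_degree G v = (\<Sum>i\<in>neighbours G v. vertex_degree G i - 1)"
  unfolding neighbours_def by (rule second_degree_altdef[OF rec])

text \<open>This is the total weight with which the next edge raises the second degree of
  \<open>v\<close>. All degrees are positive, so the truncated \<open>- 1\<close> in the second
  degree is exact.\<close>

lemma sum_neighbour_degrees:
  "(\<Sum>i\<in>neighbours G v. vertex_degree G i) = second_degree G v + card (neighbours G v)"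
proof -
  have "(\<Sum>i\<in>neighbours G v. vertex_degree G i) = (\<Sum>i\<in>neighbours G v. (vertex_degree G i - 1) + 1)"
    using vertex_degree_pos neighbours_subset[of v] by (intro sum.cong) fastforce+
  then show ?thesis unfolding second_degree_eq by (simp only: sum.distrib) simp
qed

text \<open>The left side is the degree sum over \<open>v\<close> and its neighbours. Some vertex
  \<open>x\<close>, of degree at least 1, lies outside, and all degrees add up to
  \<open>2 * m\<close>.\<close>

lemma closed_neighbourhood_degree_sum:
  assumes "v \<in> {3..m}"
  shows "2 * card (neighbours G v) + second_degree G v + (if (v, v) \<in> G then 2 else 0) \<le> 2 * m - 1"
proof -
  define S where "S = insert v (neighbours G v)"
  have S: "S \<subseteq> {1..m}" using neighbours_subset[of v] assms by (auto simp: S_def)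
  \<comment> \<open>An edge joining \<open>v\<close> to 1 or 2 is emitted by \<open>v\<close>, since
    \<open>v >= 3\<close>, and \<open>v\<close> emits only one.\<close>
  have "\<not> (1 \<in> neighbours G v \<and> 2 \<in> neighbours G v)"
  proof
    assume *: "1 \<in> neighbours G v \<and> 2 \<in> neighbours G v"
    then have "(v, 1) \<in> G" "(v, 2) \<in> G"
      using assms recursive_edge_bounds[of 1 v] recursive_edge_bounds[of 2 v]
      by (auto simp: neighbours_def adjacent_def)
    then show False using recursive_edge_unique[of v 1 2] by simp
  qed
  then obtain x where x: "x \<in> {1..m}" "x \<notin> S"
    using assms that[of 1] that[of 2] unfolding S_def by (cases "1 \<in> neighbours G v") auto
  have "(\<Sum>i\<in>S. vertex_degree G i) + vertex_degree G x = (\<Sum>i\<in>insert x S. vertex_degree G i)"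
    using x S finite_subset[OF S] by simp
  also have "\<dots> \<le> (\<Sum>i\<in>{1..m}. vertex_degree G i)"
    using x S by (intro sum_mono2) auto
  also have "\<dots> = 2 * m" by (rule sum_vertex_degree[OF rec])
  finally have "(\<Sum>i\<in>S. vertex_degree G i) + 1 \<le> 2 * m"
    using vertex_degree_pos[OF x(1)] by linarith
  moreover have "(\<Sum>i\<in>S. vertex_degree G i) = vertex_degree G v + (\<Sum>i\<in>neighbours G v. vertex_degree G i)"
    unfolding S_def using finite_neighbours[of v] by (subst sum.insert) (auto simp: neighbours_def)
  ultimately show ?thesis
    unfolding sum_neighbour_degrees using vertex_degree_eq_neighbours[of v] by linarith
qed

section \<open>Effect of a new vertex on degrees and neighbourhoods\<close>

context
  fixes i :: nat
  assumes i: "i \<in> {1..Suc m}"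
begin

lemma recursive_graph_insert: "recursive_graph (Suc m) (insert (Suc m, i) G)"
proof -
  have "(Suc m, i) \<notin> G" "Suc m \<notin> fst ` G"
    using recursive_edge_bounds by fastforce+
  then show ?thesis
    using rec i unfolding recursive_graph_def bij_betw_def by (auto simp: atLeastAtMostSuc_conv)
qed

lemma vertex_degree_insert:
  "vertex_degree (insert (Suc m, i) G) x = vertex_degree G x + of_bool (x = Suc m) + of_bool (x = i)"
proof -
  have "(Suc m, i) \<notin> G" using recursive_edge_bounds by fastforce
  moreover have "finite G" by (rule recursive_graph_finite[OF rec])
  moreover have "{e \<in> insert (Suc m, i) G. f e = x} =
      (if f (Suc m, i) = x then insert (Suc m, i) {e \<in> G. f e = x} else {e \<in> G. f e = x})"
    for f :: "nat \<times> nat \<Rightarrow> nat" by auto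
  ultimately show ?thesis unfolding vertex_degree_def by auto
qed

lemma vertex_degree_new: "vertex_degree G (Suc m) = 0"
proof -
  have "{i. (Suc m, i) \<in> G} = {}" "{i. (i, Suc m) \<in> G} = {}"
    using recursive_edge_bounds by fastforce+
  then show ?thesis by (simp add: vertex_degree_alt)
qed

lemma neighbours_insert_old:
  assumes "v \<in> {1..m}"
  shows "neighbours (insert (Suc m, i) G) v = (if i = v then insert (Suc m) (neighbours G v) else neighbours G v)"
  using assms by (auto simp: neighbours_def adjacent_def)

text \<open>If \<open>i = v\<close>, the new neighbour has degree 1 and contributes 0; if
  \<open>i\<close> is a neighbour of \<open>v\<close>, one summand grows by 1. Any other target
  changes nothing.\<close>

lemma second_degree_insert_old:
  assumes v: "v \<in> {1..m}"
  shows "second_degree (insert (Suc m, i) G) v = second_degree G v + of_bool (i \<in> neighbours G v)"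
proof -
  let ?N = "neighbours G v" and ?H = "insert (Suc m, i) G"
  have new: "Suc m \<notin> ?N" using neighbours_subset[of v] by auto
  have "second_degree ?H v = (\<Sum>j\<in>neighbours ?H v. vertex_degree ?H j - 1)"
    unfolding neighbours_def by (rule second_degree_altdef[OF recursive_graph_insert])
  also have "\<dots> = (\<Sum>j\<in>?N. vertex_degree ?H j - 1)"
    using v new finite_neighbours[of v] by (simp add: neighbours_insert_old vertex_degree_insert vertex_degree_new)
  also have "\<dots> = (\<Sum>j\<in>?N. (vertex_degree G j - 1) + of_bool (j = i))"
  proof (intro sum.cong refl)
    fix j assume "j \<in> ?N"
    then have "j \<in> {1..m}" using neighbours_subset by blast
    then show "vertex_degree ?H j - 1 = (vertex_degree G j - 1) + of_bool (j = i)"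
      using vertex_degree_pos[of j] by (auto simp: vertex_degree_insert)
  qed
  also have "\<dots> = second_degree G v + of_bool (i \<in> ?N)"
    using finite_neighbours[of v] by (simp add: second_degree_eq sum.distrib of_bool_def)
  finally show ?thesis .
qed

lemma neighbours_insert_new: "neighbours (insert (Suc m, i) G) (Suc m) = {i} - {Suc m}"
  using recursive_edge_bounds by (fastforce simp: neighbours_def adjacent_def)

text \<open>Attaching raises the degree of the only neighbour \<open>i\<close> by 1, which
  compensates the \<open>- 1\<close> in the second degree; after a loop there is no
  neighbour.\<close>

lemma second_degree_insert_new:
  "second_degree (insert (Suc m, i) G) (Suc m) = (if i = Suc m then 0 else vertex_degree G i)"
proof -
  let ?H = "insert (Suc m, i) G"
  have "second_degree ?H (Suc m) = (\<Sum>j\<in>neighbours ?H (Suc m). vertex_degree ?H j - 1)"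
    unfolding neighbours_def by (rule second_degree_altdef[OF recursive_graph_insert])
  then show ?thesis
    unfolding neighbours_insert_new by (auto simp: vertex_degree_insert insert_Diff_if)
qed

end

end

text \<open>The attachment probabilities multiplied by \<open>2 * m + 1\<close>, meant for targets
  in \<open>{1..Suc m}\<close>; the second case is the loop.\<close>

definition attachment_weight :: "nat \<Rightarrow> graph \<Rightarrow> nat \<Rightarrow> real" where
  "attachment_weight m G i = (if i \<le> m then real (vertex_degree G i) else 1)"

text \<open>
  Vertices 1 and 2 are left out: for \<open>v \<ge> 3\<close> some vertex is neither \<open>v\<close> nor a neighbour of \<open>v\<close>, so that
  all states that can occur satisfy \<open>2l + k + b < 2m\<close>, and the probability to stay in such a state
  has a nonnegative numerator \<open>2m + 1 - (2l + k + b)\<close>.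
\<close>
definition state_count :: "nat \<Rightarrow> bool \<Rightarrow> graph \<Rightarrow> nat \<Rightarrow> nat \<Rightarrow> real" where
  "state_count m b G l k =
     (\<Sum>v = 3..m. of_bool (((v, v) \<in> G) = b \<and> card (neighbours G v) = l \<and> second_degree G v = k))"

definition degree_count :: "nat \<Rightarrow> graph \<Rightarrow> nat \<Rightarrow> real" where
  "degree_count m G d = (\<Sum>v = 1..m. of_bool (vertex_degree G v = d))"

abbreviation loop_degree :: "bool \<Rightarrow> nat" where
  "loop_degree b \<equiv> (if b then 2 else 0)"

lemma sum_Suc_top:
  fixes f :: "nat \<Rightarrow> real"
  shows "a \<le> Suc m \<Longrightarrow> (\<Sum>i = a..Suc m. f i) = (\<Sum>i = a..m. f i) + f (Suc m)"
  by simp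

lemma sum_inflow: "(\<Sum>v\<in>V. inflow b (u v) l k) = inflow b (\<lambda>l k. \<Sum>v\<in>V. u v l k) l k"
  by (simp add: inflow_def sum.distrib sum_distrib_left)

section \<open>One-step sums of the counts, given the graph\<close>

context
  fixes m :: nat and G :: graph
  assumes rec: "recursive_graph m G"
begin

lemma sum_attachment_weight: "(\<Sum>i = 1..Suc m. attachment_weight m G i) = 2 * real m + 1"
proof -
  have "(\<Sum>i = 1..Suc m. attachment_weight m G i) = (\<Sum>i = 1..m. real (vertex_degree G i)) + 1"
    by (simp add: attachment_weight_def)
  also have "(\<Sum>i = 1..m. real (vertex_degree G i)) = 2 * real m"
    using sum_vertex_degree[OF rec] by (simp flip: of_nat_sum)
  finally show ?thesis .
qed

text \<open>Only two kinds of targets alter the state: \<open>v\<close> itself, of weight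
  \<open>l + loop_degree b\<close>, and its neighbours, of total weight
  \<open>l + k\<close>.\<close>

lemma generator_old_vertex:
  fixes \<phi> :: "bool \<Rightarrow> nat \<Rightarrow> nat \<Rightarrow> real"
  assumes v: "v \<in> {1..m}"
  defines "b \<equiv> (v, v) \<in> G" and "l \<equiv> card (neighbours G v)" and "k \<equiv> second_degree G v"
  shows "(\<Sum>i = 1..Suc m. attachment_weight m G i *
      \<phi> ((v, v) \<in> insert (Suc m, i) G) (card (neighbours (insert (Suc m, i) G) v))
        (second_degree (insert (Suc m, i) G) v)) =
    (2 * real m + 1) * \<phi> b l k + real (l + loop_degree b) * (\<phi> b (Suc l) k - \<phi> b l k)
      + real (l + k) * (\<phi> b l (Suc k) - \<phi> b l k)"
proof -
  let ?w = "attachment_weight m G" and ?N = "neighbours G v"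
  let ?p = "\<phi> b (Suc l) k - \<phi> b l k" and ?q = "\<phi> b l (Suc k) - \<phi> b l k"
  have N: "?N \<subseteq> {1..m}" "finite ?N" "v \<notin> ?N" "Suc m \<notin> ?N"
    using neighbours_subset[OF rec, of v] finite_neighbours[OF rec, of v]
    by (auto simp: neighbours_def)
  have "(\<Sum>i = 1..Suc m. ?w i * \<phi> ((v, v) \<in> insert (Suc m, i) G)
      (card (neighbours (insert (Suc m, i) G) v)) (second_degree (insert (Suc m, i) G) v)) =
    (\<Sum>i = 1..Suc m. ?w i * \<phi> b l k + (if i = v then ?w i * ?p else 0) + (if i \<in> ?N then ?w i * ?q else 0))"
  proof (intro sum.cong refl)
    fix i assume i: "i \<in> {1..Suc m}"
    show "?w i * \<phi> ((v, v) \<in> insert (Suc m, i) G)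
      (card (neighbours (insert (Suc m, i) G) v)) (second_degree (insert (Suc m, i) G) v) =
      ?w i * \<phi> b l k + (if i = v then ?w i * ?p else 0) + (if i \<in> ?N then ?w i * ?q else 0)"
      using v N neighbours_insert_old[OF rec i v] second_degree_insert_old[OF rec i v]
      by (auto simp: b_def l_def k_def right_diff_distrib)
  qed
  also have "\<dots> = (\<Sum>i = 1..Suc m. ?w i) * \<phi> b l k + ?w v * ?p + (\<Sum>i\<in>?N. ?w i) * ?q"
  proof -
    have "{1..Suc m} \<inter> ?N = ?N" using N by auto
    then have "(\<Sum>i = 1..Suc m. if i \<in> ?N then ?w i * ?q else 0) = (\<Sum>i\<in>?N. ?w i * ?q)"
      using sum.inter_restrict[of "{1..Suc m}" "\<lambda>i. ?w i * ?q" ?N] by simp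
    moreover have "(\<Sum>i = 1..Suc m. if i = v then ?w i * ?p else 0) = ?w v * ?p"
      using v by (subst sum.delta) auto
    ultimately show ?thesis by (simp only: sum.distrib sum_distrib_right)
  qed
  also have "?w v = real (l + loop_degree b)"
    using v vertex_degree_eq_neighbours[OF rec, of v] by (simp add: attachment_weight_def b_def l_def)
  also have "(\<Sum>i\<in>?N. ?w i) = real (\<Sum>i\<in>?N. vertex_degree G i)"
    unfolding of_nat_sum using N(1) by (intro sum.cong) (auto simp: attachment_weight_def)
  also have "\<dots> = real (l + k)"
    unfolding sum_neighbour_degrees[OF rec] by (simp add: l_def k_def add.commute)
  finally show ?thesis unfolding sum_attachment_weight .
qed

lemma degree_generator_old_vertex:
  fixes \<phi> :: "nat \<Rightarrow> real"
  assumes v: "v \<in> {1..m}"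
  defines "d \<equiv> vertex_degree G v"
  shows "(\<Sum>i = 1..Suc m. attachment_weight m G i * \<phi> (vertex_degree (insert (Suc m, i) G) v)) =
    (2 * real m + 1) * \<phi> d + real d * (\<phi> (Suc d) - \<phi> d)"
proof -
  let ?w = "attachment_weight m G"
  have "(\<Sum>i = 1..Suc m. ?w i * \<phi> (vertex_degree (insert (Suc m, i) G) v)) =
      (\<Sum>i = 1..Suc m. ?w i * \<phi> d + (if i = v then ?w i * (\<phi> (Suc d) - \<phi> d) else 0))"
    using v by (intro sum.cong refl) (auto simp: d_def vertex_degree_insert[OF rec] right_diff_distrib)
  also have "\<dots> = (\<Sum>i = 1..Suc m. ?w i) * \<phi> d + ?w v * (\<phi> (Suc d) - \<phi> d)"
  proof -
    have "(\<Sum>i = 1..Suc m. if i = v then ?w i * (\<phi> (Suc d) - \<phi> d) else 0) = ?w v * (\<phi> (Suc d) - \<phi> d)"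
      using v by (subst sum.delta) auto
    then show ?thesis by (simp only: sum.distrib sum_distrib_right)
  qed
  also have "?w v = real d" using v by (simp add: attachment_weight_def d_def)
  finally show ?thesis unfolding sum_attachment_weight .
qed

text \<open>Besides the moves from \<open>d - 1\<close> to \<open>d\<close>, a new vertex appears:
  of degree 1 when it attaches to an old vertex, total weight \<open>2 * m\<close>, or of degree 2
  by a loop, weight 1.\<close>

lemma degree_count_generator:
  "(\<Sum>i = 1..Suc m. attachment_weight m G i * degree_count (Suc m) (insert (Suc m, i) G) d) =
    (2 * real m + 1 - real d) * degree_count m G d
      + (if d = 0 then 0 else real (d - 1) * degree_count m G (d - 1))
      + 2 * real m * of_bool (d = 1) + of_bool (d = 2)"
proof -
  let ?w = "attachment_weight m G"
  have old: "(\<Sum>i = 1..Suc m. ?w i * of_bool (vertex_degree (insert (Suc m, i) G) v = d)) =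
      (2 * real m + 1 - real d) * of_bool (vertex_degree G v = d)
      + (if d = 0 then 0 else real (d - 1) * of_bool (vertex_degree G v = d - 1))" if "v \<in> {1..m}" for v
    unfolding degree_generator_old_vertex[OF that, of "\<lambda>x. of_bool (x = d)"]
    by (cases d; cases "vertex_degree G v = d") (auto simp: algebra_simps)
  have "(\<Sum>i = 1..Suc m. ?w i * of_bool (vertex_degree (insert (Suc m, i) G) (Suc m) = d)) =
      (\<Sum>i = 1..m. ?w i * of_bool (d = 1)) + of_bool (d = 2)"
    by (auto simp: vertex_degree_insert[OF rec] vertex_degree_new[OF rec] attachment_weight_def intro!: sum.cong)
  also have "(\<Sum>i = 1..m. ?w i * of_bool (d = 1)) = 2 * real m * of_bool (d = 1)"
    using sum_attachment_weight by (simp add: attachment_weight_def flip: sum_distrib_right)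
  finally have new: "(\<Sum>i = 1..Suc m. ?w i * of_bool (vertex_degree (insert (Suc m, i) G) (Suc m) = d)) =
      2 * real m * of_bool (d = 1) + of_bool (d = 2)" .
  have "(\<Sum>i = 1..Suc m. ?w i * degree_count (Suc m) (insert (Suc m, i) G) d) =
      (\<Sum>v = 1..Suc m. \<Sum>i = 1..Suc m. ?w i * of_bool (vertex_degree (insert (Suc m, i) G) v = d))"
    unfolding degree_count_def sum_distrib_left by (rule sum.swap)
  also have "\<dots> = (\<Sum>v = 1..m. \<Sum>i = 1..Suc m. ?w i * of_bool (vertex_degree (insert (Suc m, i) G) v = d))
      + (2 * real m * of_bool (d = 1) + of_bool (d = 2))"
    unfolding new[symmetric] by (rule sum_Suc_top) simp
  also have "(\<Sum>v = 1..m. \<Sum>i = 1..Suc m. ?w i * of_bool (vertex_degree (insert (Suc m, i) G) v = d)) =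
      (2 * real m + 1 - real d) * degree_count m G d
      + (if d = 0 then 0 else real (d - 1) * degree_count m G (d - 1))"
  proof -
    have "(\<Sum>v = 1..m. \<Sum>i = 1..Suc m. ?w i * of_bool (vertex_degree (insert (Suc m, i) G) v = d)) =
        (\<Sum>v = 1..m. (2 * real m + 1 - real d) * of_bool (vertex_degree G v = d)
          + (if d = 0 then 0 else real (d - 1) * of_bool (vertex_degree G v = d - 1)))"
      by (intro sum.cong refl old)
    then show ?thesis
      by (cases "d = 0") (simp_all only: degree_count_def sum.distrib sum_distrib_left simp_thms if_True if_False sum.neutral_const)
  qed
  finally show ?thesis by simp
qed

text \<open>With \<open>m >= 2\<close> the new vertex is at least 3, so it is counted. It starts in
  \<open>(1, k)\<close> when it hits a vertex of degree \<open>k\<close>, and each of these has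
  weight \<open>k\<close>; a loop starts in \<open>(0, 0)\<close> with weight 1.\<close>

lemma state_count_generator:
  assumes m: "m \<ge> 2"
  shows "(\<Sum>i = 1..Suc m. attachment_weight m G i * state_count (Suc m) b (insert (Suc m, i) G) l k) =
    (2 * real m + 1 - real (2 * l + k + loop_degree b)) * state_count m b G l k
      + inflow (loop_degree b) (state_count m b G) l k
      + (if b then of_bool (l = 0 \<and> k = 0) else of_bool (l = 1) * (real k * degree_count m G k))"
proof -
  let ?w = "attachment_weight m G"
  let ?I = "\<lambda>G v l k. of_bool (((v, v) \<in> G) = b \<and> card (neighbours G v) = l \<and> second_degree G v = k) :: real"
  let ?new = "if b then of_bool (l = 0 \<and> k = 0) else of_bool (l = 1) * (real k * degree_count m G k)"
  \<comment> \<open>For the indicator of one state the differences of \<open>\<phi>\<close> become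
    the loss from \<open>(l, k)\<close> and the inflow from its two predecessors.\<close>
  have old: "(\<Sum>i = 1..Suc m. ?w i * ?I (insert (Suc m, i) G) v l k) =
      (2 * real m + 1 - real (2 * l + k + loop_degree b)) * ?I G v l k
      + inflow (loop_degree b) (?I G v) l k" if "v \<in> {1..m}" for v
    unfolding generator_old_vertex[OF that, of "\<lambda>b' l' k'. of_bool (b' = b \<and> l' = l \<and> k' = k)"]
    by (cases "((v, v) \<in> G) = b"; cases l; cases k) (auto simp: inflow_def algebra_simps)
  have new: "(\<Sum>i = 1..Suc m. ?w i * ?I (insert (Suc m, i) G) (Suc m) l k) = ?new"
  proof -
    have noedge: "(Suc m, Suc m) \<notin> G" using recursive_edge_bounds[OF rec, of "Suc m"] by auto
    have 1: "?w i * ?I (insert (Suc m, i) G) (Suc m) l k =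
        (if b then 0 else of_bool (l = 1) * (real k * of_bool (vertex_degree G i = k)))" if "i \<in> {1..m}" for i
    proof -
      have i: "i \<in> {1..Suc m}" "i \<noteq> Suc m" "i \<le> m" using that by auto
      have "card (neighbours (insert (Suc m, i) G) (Suc m)) = 1"
        unfolding neighbours_insert_new[OF rec i(1)] using i(2) by simp
      moreover have "second_degree (insert (Suc m, i) G) (Suc m) = vertex_degree G i"
        unfolding second_degree_insert_new[OF rec i(1)] using i(2) by simp
      moreover have "(Suc m, Suc m) \<notin> insert (Suc m, i) G" using noedge i(2) by simp
      ultimately show ?thesis using i(3) by (simp add: attachment_weight_def)
    qed
    have Suc: "Suc m \<in> {1..Suc m}" by simp
    have 2: "?w (Suc m) * ?I (insert (Suc m, Suc m) G) (Suc m) l k = of_bool (b \<and> l = 0 \<and> k = 0)"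
      unfolding neighbours_insert_new[OF rec Suc] second_degree_insert_new[OF rec Suc]
      by (auto simp: attachment_weight_def)
    have "(\<Sum>i = 1..Suc m. ?w i * ?I (insert (Suc m, i) G) (Suc m) l k) =
        (\<Sum>i = 1..m. if b then 0 else of_bool (l = 1) * (real k * of_bool (vertex_degree G i = k)))
          + of_bool (b \<and> l = 0 \<and> k = 0)"
    proof -
      have "(\<Sum>i = 1..m. ?w i * ?I (insert (Suc m, i) G) (Suc m) l k) =
          (\<Sum>i = 1..m. if b then 0 else of_bool (l = 1) * (real k * of_bool (vertex_degree G i = k)))"
        by (intro sum.cong refl 1)
      then show ?thesis unfolding 2[symmetric] by (subst sum_Suc_top) simp_all
    qed
    also have "\<dots> = ?new"
      by (cases b) (simp_all add: degree_count_def sum_distrib_left)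
    finally show ?thesis .
  qed
  have "(\<Sum>i = 1..Suc m. ?w i * state_count (Suc m) b (insert (Suc m, i) G) l k) =
      (\<Sum>v = 3..Suc m. \<Sum>i = 1..Suc m. ?w i * ?I (insert (Suc m, i) G) v l k)"
    unfolding state_count_def sum_distrib_left by (rule sum.swap)
  also have "\<dots> = (\<Sum>v = 3..m. \<Sum>i = 1..Suc m. ?w i * ?I (insert (Suc m, i) G) v l k) + ?new"
    unfolding new[symmetric] by (rule sum_Suc_top) (use m in simp)
  also have "(\<Sum>v = 3..m. \<Sum>i = 1..Suc m. ?w i * ?I (insert (Suc m, i) G) v l k) =
      (\<Sum>v = 3..m. (2 * real m + 1 - real (2 * l + k + loop_degree b)) * ?I G v l k
        + inflow (loop_degree b) (?I G v) l k)"
  proof (intro sum.cong refl)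
    fix v assume "v \<in> {3..m}"
    then have "v \<in> {1..m}" by simp
    then show "(\<Sum>i = 1..Suc m. ?w i * ?I (insert (Suc m, i) G) v l k) =
        (2 * real m + 1 - real (2 * l + k + loop_degree b)) * ?I G v l k + inflow (loop_degree b) (?I G v) l k"
      by (rule old)
  qed
  also have "\<dots> = (2 * real m + 1 - real (2 * l + k + loop_degree b)) * state_count m b G l k
      + inflow (loop_degree b) (state_count m b G) l k"
    unfolding sum.distrib sum_inflow sum_distrib_left[symmetric] state_count_def by (rule refl)
  finally show ?thesis .
qed

lemma state_count_eq_0:
  assumes "2 * l + k + loop_degree b \<ge> 2 * m"
  shows "state_count m b G l k = 0"
  unfolding state_count_def
proof (intro sum.neutral ballI)
  fix v assume "v \<in> {3..m}"
  then show "of_bool (((v, v) \<in> G) = b \<and> card (neighbours G v) = l \<and> second_degree G v = k) = (0 :: real)"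
    using closed_neighbourhood_degree_sum[OF rec, of v] assms by (auto split: if_splits)
qed

lemma degree_count_eq_0:
  assumes "d \<ge> m + 2"
  shows "degree_count m G d = 0"
proof -
  have "vertex_degree G v \<noteq> d" for v
    using vertex_degree_le[OF rec, of v] assms by linarith
  then show ?thesis by (simp add: degree_count_def)
qed

end

section \<open>Expectations over the random graph\<close>

lemma finite_set_bollobas_riordan: "finite (set_pmf (bollobas_riordan n))"
proof (rule finite_subset)
  show "set_pmf (bollobas_riordan n) \<subseteq> Pow ({1..n} \<times> {1..n})"
    using recursive_edge_bounds[OF recursive_graph_bollobas_riordan] by fastforce
qed simp

abbreviation br_expectation :: "nat \<Rightarrow> (graph \<Rightarrow> real) \<Rightarrow> real" where
  "br_expectation n \<equiv> measure_pmf.expectation (bollobas_riordan n)"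

lemma integrable_bollobas_riordan [simp]: "integrable (measure_pmf (bollobas_riordan n)) (f :: graph \<Rightarrow> real)"
  by (rule integrable_measure_pmf_finite[OF finite_set_bollobas_riordan])

lemma br_expectation_cong:
  "(\<And>G. recursive_graph n G \<Longrightarrow> f G = g G) \<Longrightarrow> br_expectation n f = br_expectation n g"
  by (intro integral_cong_AE) (auto simp: AE_measure_pmf_iff dest: recursive_graph_bollobas_riordan)

lemma br_expectation_mono:
  "(\<And>G. recursive_graph n G \<Longrightarrow> f G \<le> g G) \<Longrightarrow> br_expectation n f \<le> br_expectation n g"
  by (intro integral_mono_AE) (auto simp: AE_measure_pmf_iff dest: recursive_graph_bollobas_riordan)

lemma br_expectation_inflow:
  "br_expectation n (\<lambda>G. inflow b (u G) l k) = inflow b (\<lambda>l k. br_expectation n (\<lambda>G. u G l k)) l k"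
  by (simp add: inflow_def)

text \<open>Conditioning on the graph at time \<open>m\<close>; the factor clears the denominator
  \<open>2 * (m + 1) - 1\<close> of the attachment law.\<close>

lemma br_expectation_Suc:
  assumes m: "m \<ge> 1"
  shows "(2 * real m + 1) * br_expectation (Suc m) f =
    br_expectation m (\<lambda>G. \<Sum>i = 1..Suc m. attachment_weight m G i * f (insert (Suc m, i) G))"
proof -
  obtain j where j: "m = Suc j" using m by (cases m) auto
  let ?S = "set_pmf (bollobas_riordan m)"
  have attached: "i \<in> {1..Suc m}" if "G \<in> ?S" "i \<in> set_pmf (attachment (Suc m) G)" for G i
    using that(2) pmf_attachment[of "Suc m" G i] recursive_graph_bollobas_riordan[OF that(1)]
    by (auto simp: set_pmf_iff split: if_splits)
  have step: "measure_pmf.expectation (map_pmf (\<lambda>i. insert (Suc m, i) G) (attachment (Suc m) G)) f =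
      (\<Sum>i = 1..Suc m. attachment_weight m G i * f (insert (Suc m, i) G)) / (2 * real m + 1)"
    if "G \<in> ?S" for G
  proof -
    have rec: "recursive_graph (Suc m - 1) G" using recursive_graph_bollobas_riordan[OF that] by simp
    have "measure_pmf.expectation (map_pmf (\<lambda>i. insert (Suc m, i) G) (attachment (Suc m) G)) f =
        (\<Sum>i = 1..Suc m. f (insert (Suc m, i) G) * pmf (attachment (Suc m) G) i)"
      unfolding integral_map_pmf using attached[OF that] by (intro integral_measure_pmf_real) auto
    also have "\<dots> = (\<Sum>i = 1..Suc m. attachment_weight m G i * f (insert (Suc m, i) G) / (2 * real m + 1))"
      using pmf_attachment[OF rec] by (intro sum.cong) (auto simp: attachment_weight_def add.commute mult.commute)
    finally show ?thesis by (simp only: sum_divide_distrib)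
  qed
  have br: "bollobas_riordan (Suc m) =
      bind_pmf (bollobas_riordan m) (\<lambda>G. map_pmf (\<lambda>i. insert (Suc m, i) G) (attachment (Suc m) G))"
    by (simp add: j map_pmf_def)
  have "br_expectation (Suc m) f = (\<Sum>G\<in>?S. pmf (bollobas_riordan m) G *\<^sub>R
      measure_pmf.expectation (map_pmf (\<lambda>i. insert (Suc m, i) G) (attachment (Suc m) G)) f)"
    unfolding br
  proof (rule pmf_expectation_bind)
    show "finite (set_pmf (map_pmf (\<lambda>i. insert (Suc m, i) G) (attachment (Suc m) G)))" if "G \<in> ?S" for G
      using attached[OF that] finite_subset[of _ "{1..Suc m}"] by (simp add: subset_iff)
  qed (simp_all add: finite_set_bollobas_riordan)
  also have "\<dots> = (\<Sum>G\<in>?S. pmf (bollobas_riordan m) G *\<^sub>R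
      ((\<Sum>i = 1..Suc m. attachment_weight m G i * f (insert (Suc m, i) G)) / (2 * real m + 1)))"
    by (intro sum.cong refl) (simp only: step)
  also have "\<dots> = br_expectation m (\<lambda>G. (\<Sum>i = 1..Suc m. attachment_weight m G i * f (insert (Suc m, i) G)) / (2 * real m + 1))"
    by (subst integral_measure_pmf[OF finite_set_bollobas_riordan]) auto
  finally show ?thesis by simp
qed

section \<open>Comparison with the stationary solutions\<close>

definition expected_degree_count :: "nat \<Rightarrow> nat \<Rightarrow> real" where
  "expected_degree_count n d = br_expectation n (\<lambda>G. degree_count n G d)"

definition expected_state_count :: "nat \<Rightarrow> bool \<Rightarrow> nat \<Rightarrow> nat \<Rightarrow> real" where
  "expected_state_count n b l k = br_expectation n (\<lambda>G. state_count n b G l k)"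

lemma expected_degree_count_Suc:
  assumes "m \<ge> 1"
  shows "(2 * real m + 1) * expected_degree_count (Suc m) d =
    (2 * real m + 1 - real d) * expected_degree_count m d
      + (if d = 0 then 0 else real (d - 1) * expected_degree_count m (d - 1))
      + 2 * real m * of_bool (d = 1) + of_bool (d = 2)"
proof -
  have "(2 * real m + 1) * expected_degree_count (Suc m) d = br_expectation m (\<lambda>G.
      (2 * real m + 1 - real d) * degree_count m G d
      + (if d = 0 then 0 else real (d - 1) * degree_count m G (d - 1))
      + 2 * real m * of_bool (d = 1) + of_bool (d = 2))"
    unfolding expected_degree_count_def br_expectation_Suc[OF assms]
    by (intro br_expectation_cong degree_count_generator)
  then show ?thesis by (simp add: expected_degree_count_def)
qed

lemma expected_state_count_Suc:
  assumes "m \<ge> 2"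
  shows "(2 * real m + 1) * expected_state_count (Suc m) b l k =
    (2 * real m + 1 - real (2 * l + k + loop_degree b)) * expected_state_count m b l k
      + inflow (loop_degree b) (expected_state_count m b) l k
      + (if b then of_bool (l = 0 \<and> k = 0) else of_bool (l = 1) * (real k * expected_degree_count m k))"
proof -
  have m: "m \<ge> 1" using assms by simp
  let ?s = "\<lambda>G. if b then of_bool (l = 0 \<and> k = 0) else of_bool (l = 1) * (real k * degree_count m G k)"
  have "(2 * real m + 1) * expected_state_count (Suc m) b l k = br_expectation m (\<lambda>G.
      (2 * real m + 1 - real (2 * l + k + loop_degree b)) * state_count m b G l k
      + inflow (loop_degree b) (state_count m b G) l k + ?s G)"
    unfolding expected_state_count_def br_expectation_Suc[OF m]
    by (intro br_expectation_cong state_count_generator assms)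
  also have "\<dots> = (2 * real m + 1 - real (2 * l + k + loop_degree b)) * br_expectation m (\<lambda>G. state_count m b G l k)
      + br_expectation m (\<lambda>G. inflow (loop_degree b) (state_count m b G) l k) + br_expectation m ?s"
    by (subst Bochner_Integration.integral_add, simp, simp)+ simp
  also have "br_expectation m ?s =
      (if b then of_bool (l = 0 \<and> k = 0) else of_bool (l = 1) * (real k * expected_degree_count m k))"
    by (simp add: expected_degree_count_def)
  also have "br_expectation m (\<lambda>G. inflow (loop_degree b) (state_count m b G) l k) =
      inflow (loop_degree b) (expected_state_count m b) l k"
    unfolding br_expectation_inflow by (simp add: inflow_def expected_state_count_def)
  finally show ?thesis by (simp only: expected_state_count_def)
qed

lemma expected_state_count_eq_0:
  assumes "2 * l + k + loop_degree b \<ge> 2 * n"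
  shows "expected_state_count n b l k = 0"
proof -
  have "expected_state_count n b l k = br_expectation n (\<lambda>_. 0)"
    unfolding expected_state_count_def by (intro br_expectation_cong state_count_eq_0 assms)
  then show ?thesis by simp
qed

lemma expected_degree_count_eq_0:
  assumes "d \<ge> n + 2"
  shows "expected_degree_count n d = 0"
proof -
  have "expected_degree_count n d = br_expectation n (\<lambda>_. 0)"
    unfolding expected_degree_count_def by (intro br_expectation_cong degree_count_eq_0 assms)
  then show ?thesis by simp
qed

lemma expected_state_count_2: "expected_state_count 2 b l k = 0"
  by (simp add: expected_state_count_def state_count_def)

lemma expected_degree_count_1: "expected_degree_count 1 d = of_bool (d = 2)"
proof -
  have "vertex_degree {(1, 1)} 1 = 2"
    by (simp add: vertex_degree_alt[of 1] recursive_graph_def bij_betw_def)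
  then show ?thesis
    by (auto simp: expected_degree_count_def degree_count_def)
qed

text \<open>The shift \<open>1/2\<close> makes the linear ansatz solve the recurrence exactly for \<open>d \<ge> 3\<close>.\<close>
lemma expected_degree_count_deviation:
  assumes "n \<ge> 1" "d \<ge> 1"
  shows "\<bar>expected_degree_count n d - 4 * (real n + 1/2) / (real d * (real d + 1) * (real d + 2))\<bar>
    \<le> (if d = 1 then 1 else 2 / real d)"
  using assms
proof (induction n arbitrary: d rule: nat_induct_at_least)
  case base
  consider "d = 1" | "d = 2" | "d \<ge> 3" using base by linarith
  then show ?case
  proof cases
    case 3
    define x where "x = real d"
    have x: "x \<ge> 3" using 3 by (simp add: x_def)
    have "6 / (x * (x + 1) * (x + 2)) \<le> 6 / (x * 1 * 3)"
      using x by (intro divide_left_mono mult_mono) auto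
    then show ?thesis using 3 x by (simp add: expected_degree_count_1 x_def[symmetric] del: One_nat_def)
  qed (simp_all add: expected_degree_count_1 del: One_nat_def)
next
  case (Suc m)
  define p where "p x = 4 / (x * (x + 1) * (x + 2))" for x :: real
  define y where "y = real m"
  define \<delta> where "\<delta> d = expected_degree_count m d - p (real d) * (y + 1/2)" for d
  define \<delta>' where "\<delta>' = expected_degree_count (Suc m) d - p (real d) * (y + 3/2)"
  have y: "y \<ge> 1" using Suc by (simp add: y_def)
  have IH: "\<bar>\<delta> d\<bar> \<le> (if d = 1 then 1 else 2 / real d)" if "d \<ge> 1" for d
    using Suc.IH[OF that] by (simp add: \<delta>_def p_def y_def)
  have "\<bar>\<delta>'\<bar> \<le> (if d = 1 then 1 else 2 / real d)"
  \<comment> \<open>From \<open>d = 2 * m + 2\<close> on, the coefficient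
    \<open>2 * m + 1 - d\<close> is negative, which spoils the triangle inequality. But no degree at
    time \<open>Suc m\<close> is that large, so the deviation is minus the ansatz.\<close>
  proof (cases "d \<ge> 2 * m + 2")
    case True
    define x where "x = real d"
    have x: "x \<ge> 2 * y + 2" using True by (simp add: x_def y_def)
    have "\<delta>' = - (p x * (y + 3/2))"
      using True Suc.hyps by (simp add: \<delta>'_def x_def expected_degree_count_eq_0)
    moreover have "p x \<ge> 0" using x y by (simp add: p_def)
    ultimately have "\<bar>\<delta>'\<bar> = p x * (y + 3/2)" using y by simp
    also have "\<dots> \<le> p x * ((x + 1) / 2)" using x \<open>p x \<ge> 0\<close> by (intro mult_left_mono) auto
    also have "\<dots> = 2 / (x * (x + 2))"
      using x y by (simp add: p_def divide_simps) (simp add: algebra_simps)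
    also have "\<dots> \<le> 2 / (x * 1)" using x y by (intro divide_left_mono mult_left_mono) auto
    finally show ?thesis using True by (simp add: x_def)
  next
    case False
    then have d: "real d \<le> 2 * y + 1" by (simp add: y_def)
    have rec: "(2 * y + 1) * expected_degree_count (Suc m) d =
        (2 * y + 1 - real d) * expected_degree_count m d + real (d - 1) * expected_degree_count m (d - 1)
        + 2 * y * of_bool (d = 1) + of_bool (d = 2)"
      using expected_degree_count_Suc[OF Suc.hyps, of d] Suc.prems by (simp add: y_def)
    have "\<bar>(2 * y + 1) * \<delta>'\<bar> \<le> (2 * y + 1) * (if d = 1 then 1 else 2 / real d)"
    proof (cases "d = 1")
      case True
      have "(2 * y + 1) * \<delta>' = 2 * y * \<delta> 1 - 1"
        using rec True by (simp add: \<delta>_def \<delta>'_def p_def algebra_simps)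
      moreover have "\<bar>2 * y * \<delta> 1\<bar> \<le> 2 * y * 1" using IH[of 1] y unfolding abs_mult by (intro mult_mono) auto
      ultimately show ?thesis using True by simp
    next
      case d1: False
      then have d2: "d \<ge> 2" using Suc.prems by simp
      define x where "x = real d"
      have x: "x \<ge> 2" using d2 by (simp add: x_def)
      have pred: "real (d - 1) = x - 1" using d2 by (simp add: x_def of_nat_diff)
      \<comment> \<open>Stationarity of \<open>p\<close>; together with
        \<open>(2 * y + 3) (y + 1/2) = (2 * y + 1) (y + 3/2)\<close> it makes the ansatz
        cancel.\<close>
      have "(x - 1) * p (x - 1) = 4 / (x * (x + 1))"
        using x by (simp add: p_def divide_simps) (simp add: algebra_simps)
      also have "\<dots> = (x + 2) * p x" using x by (simp add: p_def divide_simps)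
      finally have "(2 * y + 1 - x) * p x + (x - 1) * p (x - 1) = (2 * y + 3) * p x"
        by (simp add: algebra_simps)
      then have "((2 * y + 1 - x) * p x + (x - 1) * p (x - 1)) * (y + 1/2) = (2 * y + 3) * p x * (y + 1/2)"
        by (simp only:)
      also have "\<dots> = (2 * y + 1) * (p x * (y + 3/2))"
        by (simp add: algebra_simps)
      finally have balanced: "((2 * y + 1 - x) * p x + (x - 1) * p (x - 1)) * (y + 1/2) = (2 * y + 1) * (p x * (y + 3/2))" .
      have "(2 * y + 1) * \<delta>' = (2 * y + 1 - x) * \<delta> d + (x - 1) * \<delta> (d - 1) + of_bool (d = 2)"
      proof -
        have "a * (D - c * r) + b * (D' - c' * r) = a * D + b * D' - (a * c + b * c') * r"
          for a b c c' r D D' :: real by (simp add: algebra_simps)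
        note this[of "2 * y + 1 - x" _ "p x" "y + 1/2" "x - 1" _ "p (x - 1)", unfolded balanced]
        then show ?thesis
          unfolding \<delta>_def \<delta>'_def right_diff_distrib[of "2 * y + 1"] rec pred x_def[symmetric] using d1 by simp
      qed
      moreover have "\<bar>(2 * y + 1 - x) * \<delta> d\<bar> \<le> (2 * y + 1 - x) * (2 / x)"
        unfolding abs_mult using IH[of d] d d2 by (intro mult_mono) (auto simp: x_def)
      \<comment> \<open>The smaller bound 1 at \<open>d = 1\<close> leaves room for the loop source
        at \<open>d = 2\<close>; for larger \<open>d\<close> the bound on the inflow alone is
        2.\<close>
      moreover have "\<bar>(x - 1) * \<delta> (d - 1)\<bar> + of_bool (d = 2) \<le> 2"
      proof -
        have "\<bar>(x - 1) * \<delta> (d - 1)\<bar> \<le> (x - 1) * (if d - 1 = 1 then 1 else 2 / (x - 1))"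
          unfolding abs_mult using IH[of "d - 1"] d2 x pred by (intro mult_mono) auto
        moreover have "(x - 1) * (2 / (x - 1)) = 2" using x by (simp only: times_divide_eq_right nonzero_mult_div_cancel_left)
        moreover have "d - 1 = 1 \<longleftrightarrow> d = 2" using d2 by auto
        ultimately show ?thesis by (cases "d = 2") (auto simp: x_def)
      qed
      moreover have "(2 * y + 1 - x) * (2 / x) + 2 = (2 * y + 1) * (2 / x)"
        using x by (simp add: field_simps)
      ultimately show ?thesis using d1 unfolding x_def[symmetric] by (auto split: split_of_bool)
    qed
    then show ?thesis using y by (simp only: abs_mult) (simp add: mult_le_cancel_left_pos)
  qed
  then show ?case by (simp add: \<delta>'_def p_def y_def add.commute)
qed

text \<open>The deviation obeys the recurrence of the counts with a source of size at most 2. With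
  \<open>h = 2l + k <= 2 * m + 1\<close>, the bound \<open>A = deviation_bound l k\<close> is passed
  on: staying contributes at most \<open>(2 * m + 1 - h) A\<close>, inflow and source together at
  most \<open>h A\<close>.\<close>

lemma expected_state_count_deviation:
  "n \<ge> 2 \<Longrightarrow> \<bar>expected_state_count n False l k - (real n + 1/2) * limit_density l k\<bar> \<le> deviation_bound l k"
proof (induction n arbitrary: l k rule: nat_induct_at_least)
  case base
  \<comment> \<open>At \<open>n = 2\<close> the count is 0 and the deviation is \<open>5/2\<close>
    times the density; off the axes \<open>2l + k + 2 >= 5\<close>.\<close>
  have "5 / 2 * limit_density l k \<le> deviation_bound l k"
  proof (cases "l = 0 \<or> k = 0")
    case True
    then show ?thesis using limit_density_eq_0[OF True] deviation_bound_nonneg by simp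
  next
    case False
    have "limit_density l k * (5 / 2) \<le> limit_density l k * (real (2 * l + k + 2) / 2)"
      using False limit_density_nonneg by (intro mult_left_mono) auto
    then show ?thesis using limit_density_le_deviation_bound[of l k] by simp
  qed
  then show ?case using limit_density_nonneg[of l k] by (simp add: expected_state_count_2)
next
  case (Suc m)
  define y where "y = real m"
  define \<theta> where "\<theta> l k = expected_state_count m False l k - (y + 1/2) * limit_density l k" for l k
  define \<theta>' where "\<theta>' = expected_state_count (Suc m) False l k - (y + 3/2) * limit_density l k"
  have y: "y \<ge> 2" using Suc by (simp add: y_def)
  have IH: "\<bar>\<theta> l k\<bar> \<le> deviation_bound l k" for l k
    using Suc.IH[of l k] by (simp add: \<theta>_def y_def)
  have "\<bar>\<theta>'\<bar> \<le> deviation_bound l k"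
  \<comment> \<open>The coefficient is negative only where the state is still empty at time
    \<open>Suc m\<close>.\<close>
  proof (cases "2 * l + k \<ge> 2 * m + 2")
    case True
    have "limit_density l k * (y + 3 / 2) \<le> limit_density l k * (real (2 * l + k + 2) / 2)"
      using True limit_density_nonneg by (intro mult_left_mono) (auto simp: y_def)
    moreover have "\<theta>' = - (limit_density l k * (y + 3 / 2))"
      using True by (simp add: \<theta>'_def expected_state_count_eq_0)
    ultimately show ?thesis
      using limit_density_le_deviation_bound[of l k] limit_density_nonneg[of l k] y by simp
  next
    case False
    define h where "h = real (2 * l + k)"
    have h: "h \<le> 2 * y + 1" using False by (simp add: h_def y_def)
    define s where "s = of_bool (l = 1) * (real k * expected_degree_count m k)"
    define \<sigma> where "\<sigma> = (if l = 1 \<and> k \<ge> 1 then 4 / (real (k + 1) * real (k + 2)) else 0)"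
    have source: "\<bar>s - (y + 1/2) * \<sigma>\<bar> \<le> (if l = 1 \<and> k \<ge> 1 then 2 else 0)"
    proof (cases "l = 1 \<and> k \<ge> 1")
      case True
      define x where "x = real k"
      define \<delta> where "\<delta> = expected_degree_count m k - 4 * (y + 1/2) / (x * (x + 1) * (x + 2))"
      have x: "x \<ge> 1" using True by (simp add: x_def)
      have "\<bar>\<delta>\<bar> \<le> 2 / x"
        using expected_degree_count_deviation[of m k] Suc.hyps True
        by (auto simp: \<delta>_def x_def y_def split: if_splits)
      then have "\<bar>x * \<delta>\<bar> \<le> 2" using x by (simp add: abs_mult field_simps)
      moreover have "s - (y + 1/2) * \<sigma> = x * \<delta>"
        using True x by (simp add: s_def \<sigma>_def \<delta>_def x_def[symmetric] right_diff_distrib add.commute mult_ac)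
      ultimately show ?thesis using True by simp
    qed (auto simp: s_def \<sigma>_def)
    have N: "(2 * y + 1) * expected_state_count (Suc m) False l k =
        (2 * y + 1 - h) * expected_state_count m False l k + inflow 0 (expected_state_count m False) l k + s"
      using expected_state_count_Suc[OF Suc.hyps, of False l k] by (simp add: y_def h_def s_def)
    have c: "(h + 2) * limit_density l k = inflow 0 limit_density l k + \<sigma>"
    proof -
      have "h + 2 = real (2 * l + k + 2)" by (simp add: h_def)
      then show ?thesis unfolding \<sigma>_def using limit_density_eq[of l k] by (simp only:)
    qed
    have A: "h * deviation_bound l k = inflow 0 deviation_bound l k + (if l = 1 \<and> k \<ge> 1 then 2 else 0)"
      using deviation_bound_eq[of l k] unfolding h_def by simp
    define r where "r = y + 1/2"
    have "(2 * y + 1) * \<theta>' = (2 * y + 1 - h) * \<theta> l k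
        + (inflow 0 (expected_state_count m False) l k - (y + 1/2) * inflow 0 limit_density l k)
        + (s - (y + 1/2) * \<sigma>)"
    proof -
      have "r * inflow 0 limit_density l k = r * ((h + 2) * limit_density l k - \<sigma>)" using c by simp
      moreover have "(2 * y + 1) * (y + 3/2) = (2 * y + 3) * r" by (simp add: r_def algebra_simps)
      then have "(2 * y + 1) * ((y + 3/2) * limit_density l k) = (2 * y + 3) * r * limit_density l k"
        by (simp only: mult.assoc[symmetric])
      ultimately show ?thesis
        unfolding \<theta>'_def \<theta>_def r_def[symmetric] right_diff_distrib N by (simp add: algebra_simps)
    qed
    also have "inflow 0 (expected_state_count m False) l k - (y + 1/2) * inflow 0 limit_density l k = inflow 0 \<theta> l k"
      unfolding inflow_diff_scaled \<theta>_def ..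
    finally have "(2 * y + 1) * \<theta>' = (2 * y + 1 - h) * \<theta> l k + inflow 0 \<theta> l k + (s - (y + 1/2) * \<sigma>)" .
    moreover have "\<bar>(2 * y + 1 - h) * \<theta> l k\<bar> \<le> (2 * y + 1 - h) * deviation_bound l k"
      unfolding abs_mult using h IH by (intro mult_mono) auto
    moreover have "\<bar>inflow 0 \<theta> l k\<bar> \<le> inflow 0 deviation_bound l k"
      by (rule order.trans[OF abs_inflow_le inflow_mono]) (rule IH)
    ultimately have "\<bar>(2 * y + 1) * \<theta>'\<bar> \<le> (2 * y + 1 - h) * deviation_bound l k + h * deviation_bound l k"
      using source A by linarith
    also have "\<dots> = (2 * y + 1) * deviation_bound l k" by (simp add: algebra_simps)
    finally show ?thesis using y by (simp only: abs_mult) (simp add: mult_le_cancel_left_pos)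
  qed
  then show ?case by (simp add: \<theta>'_def y_def add.commute)
qed

text \<open>Loops appear with weight 1 against the total weight \<open>2 * m + 1\<close>, so no
  linear part is needed: the time-independent \<open>loop_bound\<close> is a supersolution.\<close>

lemma expected_loop_count_le:
  "n \<ge> 2 \<Longrightarrow> expected_state_count n True l k \<le> loop_bound l k"
proof (induction n arbitrary: l k rule: nat_induct_at_least)
  case base
  show ?case by (simp add: expected_state_count_2 loop_bound_nonneg)
next
  case (Suc m)
  show ?case
  proof (cases "2 * l + k + 2 \<ge> 2 * m + 2")
    case True
    then show ?thesis by (simp add: expected_state_count_eq_0 loop_bound_nonneg)
  next
    case False
    define y where "y = real m"
    define h where "h = real (2 * l + k + 2)"
    have h: "h \<le> 2 * y + 1" using False by (simp add: h_def y_def)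
    have y: "y \<ge> 2" using Suc by (simp add: y_def)
    have "(2 * y + 1) * expected_state_count (Suc m) True l k =
        (2 * y + 1 - h) * expected_state_count m True l k + inflow 2 (expected_state_count m True) l k
        + of_bool (l = 0 \<and> k = 0)"
      using expected_state_count_Suc[OF Suc.hyps, of True l k] by (simp add: y_def h_def)
    also have "\<dots> \<le> (2 * y + 1 - h) * loop_bound l k + inflow 2 loop_bound l k + of_bool (l = 0 \<and> k = 0)"
      using h Suc.IH by (intro add_mono mult_left_mono inflow_mono) auto
    also have "\<dots> = (2 * y + 1 - h) * loop_bound l k + h * loop_bound l k"
      using loop_bound_eq[of l k] unfolding h_def by simp
    also have "\<dots> = (2 * y + 1) * loop_bound l k" by (simp add: algebra_simps)
    finally show ?thesis using y by (simp add: mult_le_cancel_left_pos)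
  qed
qed

text \<open>No vertex has more than \<open>n\<close> neighbours, so the cut-off \<open>L\<close>
  loses nothing; the slack 2 pays for the uncounted vertices 1 and 2.\<close>

lemma second_degree_count_decomposition:
  fixes n k L :: nat
  assumes rec: "recursive_graph n G" and "n \<ge> 2" "L \<ge> n"
  defines "X \<equiv> real (card {t \<in> {1..n}. second_degree G t = k})"
    and "Y \<equiv> (\<Sum>l\<le>L. state_count n False G l k) + (\<Sum>l\<le>L. state_count n True G l k)"
  shows "Y \<le> X \<and> X \<le> Y + 2"
proof -
  have count: "(\<Sum>l\<le>L. state_count n b G l k) =
      (\<Sum>v = 3..n. of_bool (((v, v) \<in> G) = b \<and> second_degree G v = k))" for b
  proof -
    have "(\<Sum>l\<le>L. state_count n b G l k) = (\<Sum>v = 3..n. \<Sum>l\<le>L.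
        of_bool (((v, v) \<in> G) = b \<and> card (neighbours G v) = l \<and> second_degree G v = k))"
      unfolding state_count_def by (rule sum.swap)
    also have "\<dots> = (\<Sum>v = 3..n. of_bool (((v, v) \<in> G) = b \<and> second_degree G v = k))"
    proof (intro sum.cong refl)
      fix v
      have le: "card (neighbours G v) \<le> L" using card_neighbours_le[OF rec, of v] assms(3) by simp
      have "(\<Sum>l\<le>L. of_bool (((v, v) \<in> G) = b \<and> card (neighbours G v) = l \<and> second_degree G v = k)) =
          (\<Sum>l\<le>L. if l = card (neighbours G v) then of_bool (((v, v) \<in> G) = b \<and> second_degree G v = k) else 0 :: real)"
        by (intro sum.cong) auto
      then show "(\<Sum>l\<le>L. of_bool (((v, v) \<in> G) = b \<and> card (neighbours G v) = l \<and> second_degree G v = k)) =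
          (of_bool (((v, v) \<in> G) = b \<and> second_degree G v = k) :: real)"
        using le by (subst (asm) sum.delta) auto
    qed
    finally show ?thesis .
  qed
  have Y: "Y = (\<Sum>v = 3..n. of_bool (second_degree G v = k))"
    unfolding Y_def count sum.distrib[symmetric] by (intro sum.cong refl) auto
  have "X = (\<Sum>v = 1..n. of_bool (second_degree G v = k))"
    unfolding X_def by (simp add: Int_def)
  also have "{1..n} = insert 1 (insert 2 {3..n})" using assms(2) by auto
  finally have "X = of_bool (second_degree G 1 = k) + of_bool (second_degree G 2 = k) + Y"
    unfolding Y by simp
  then show ?thesis by auto
qed

section \<open>Linearity of the expected count up to a bounded error\<close>

lemma sum_limit_density_tendsto: "(\<lambda>L. \<Sum>l\<le>L. limit_density l k) \<longlonglongrightarrow> moment 0 k"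
  using sums_moment[of 0 k] by (simp add: sums_def_le)

text \<open>The density lies below \<open>deviation_bound\<close> because
  \<open>(2l + k + 2) / 2 >= 1\<close>. This crude bound serves to drop the shift \<open>1/2\<close>
  and to settle \<open>n = 1\<close>.\<close>

lemma moment_0_le:
  assumes "k \<ge> 1"
  shows "moment 0 k \<le> 2"
proof (rule LIMSEQ_le_const2[OF sum_limit_density_tendsto])
  have "limit_density l k \<le> deviation_bound l k" for l
  proof -
    have "limit_density l k * 1 \<le> limit_density l k * (real (2 * l + k + 2) / 2)"
      using limit_density_nonneg by (intro mult_left_mono) auto
    then show ?thesis using limit_density_le_deviation_bound[of l k] by simp
  qed
  then show "\<exists>N. \<forall>L\<ge>N. (\<Sum>l\<le>L. limit_density l k) \<le> 2"
    by (intro exI allI impI order.trans[OF sum_mono sum_deviation_bound[OF assms]])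
qed

lemma expected_second_degree_count_linear:
  assumes "n \<ge> 1" "k \<ge> 1"
  shows "\<bar>expected_second_degree_count n k - real n * moment 0 k\<bar> \<le> 6"
proof (cases "n \<ge> 2")
  case False
  then have n: "n = 1" using assms by simp
  have "card {t \<in> {1..n}. second_degree {(1, 1)} t = k} \<le> card {1..n}" by (intro card_mono) auto
  then have "0 \<le> expected_second_degree_count n k" "expected_second_degree_count n k \<le> 1"
    by (simp_all add: expected_second_degree_count_def n)
  then show ?thesis using moment_0_le[OF assms(2)] moment_nonneg[of 0 k] unfolding n by simp
next
  case True
  define M where "M = expected_second_degree_count n k"
  \<comment> \<open>The 5 collects 2 for the vertices 1 and 2, 1 for looped vertices and 2 for the
    deviation. It does not depend on \<open>L\<close>, so \<open>L\<close> can tend to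
    infinity.\<close>
  have bound: "\<bar>M - (real n + 1/2) * (\<Sum>l\<le>L. limit_density l k)\<bar> \<le> 5" if L: "L \<ge> n" for L
  proof -
    define N where "N = (\<Sum>l\<le>L. expected_state_count n False l k)"
    define P where "P = (\<Sum>l\<le>L. expected_state_count n True l k)"
    have E: "br_expectation n (\<lambda>G. (\<Sum>l\<le>L. state_count n False G l k) + (\<Sum>l\<le>L. state_count n True G l k)) = N + P"
      by (simp add: N_def P_def expected_state_count_def)
    have "N + P \<le> M" unfolding E[symmetric] M_def expected_second_degree_count_def
      using second_degree_count_decomposition[OF _ True L] by (intro br_expectation_mono) auto
    moreover have "M \<le> br_expectation n (\<lambda>G. ((\<Sum>l\<le>L. state_count n False G l k) + (\<Sum>l\<le>L. state_count n True G l k)) + 2)"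
      unfolding M_def expected_second_degree_count_def
      using second_degree_count_decomposition[OF _ True L] by (intro br_expectation_mono) auto
    then have "M \<le> N + P + 2" by (simp add: E[symmetric])
    moreover have "P \<le> 1"
      unfolding P_def
      by (intro order.trans[OF sum_mono sum_loop_bound[OF assms(2)]] expected_loop_count_le[OF True])
    moreover have "P \<ge> 0"
      unfolding P_def expected_state_count_def state_count_def by (intro sum_nonneg integral_nonneg) auto
    moreover have "\<bar>N - (real n + 1/2) * (\<Sum>l\<le>L. limit_density l k)\<bar> \<le> 2"
    proof -
      have "\<bar>N - (real n + 1/2) * (\<Sum>l\<le>L. limit_density l k)\<bar> =
          \<bar>\<Sum>l\<le>L. expected_state_count n False l k - (real n + 1/2) * limit_density l k\<bar>"
        by (simp only: N_def sum_subtractf sum_distrib_left)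
      also have "\<dots> \<le> (\<Sum>l\<le>L. deviation_bound l k)"
        by (rule order.trans[OF sum_abs sum_mono]) (rule expected_state_count_deviation[OF True])
      also have "\<dots> \<le> 2" by (rule sum_deviation_bound[OF assms(2)])
      finally show ?thesis .
    qed
    ultimately show ?thesis by linarith
  qed
  have "(\<lambda>L. \<bar>M - (real n + 1/2) * (\<Sum>l\<le>L. limit_density l k)\<bar>) \<longlonglongrightarrow> \<bar>M - (real n + 1/2) * moment 0 k\<bar>"
    by (intro tendsto_intros sum_limit_density_tendsto)
  then have "\<bar>M - (real n + 1/2) * moment 0 k\<bar> \<le> 5"
    using bound by (intro LIMSEQ_le_const2) auto
  moreover have "(real n + 1/2) * moment 0 k = real n * moment 0 k + moment 0 k / 2" by (simp add: algebra_simps)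
  ultimately show ?thesis
    unfolding M_def[symmetric] using moment_0_le[OF assms(2)] moment_nonneg[of 0 k] by linarith
qed

theorem theorem2:
  "\<exists>C::real. C > 0 \<and>
     (\<forall>n k :: nat. n \<ge> 1 \<longrightarrow> k \<ge> 2 \<longrightarrow>
       (\<exists>E::real.
          expected_second_degree_count n k = 4 * real n / (real k)^2 * (1 + E) \<and>
          \<bar>E\<bar> \<le> C * ((ln (real k))^2 / real k + (real k)^2 / real n)))"
proof (rule exI[of _ 81], intro conjI allI impI)
  fix n k :: nat
  assume n: "n \<ge> 1" and k: "k \<ge> 2"
  define x where "x = real k"
  define y where "y = real n"
  define M where "M = expected_second_degree_count n k"
  have x: "x > 0" and y: "y > 0" using n k by (simp_all add: x_def y_def)
  define E where "E = M * x\<^sup>2 / (4 * y) - 1"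
  \<comment> \<open>Relative to the main term, \<open>E\<close> splits into the finite-size error of
    \<open>M\<close>, at most 6 in absolute value, and the error of the limiting mass.\<close>
  have "E = (M - y * moment 0 k) * (x\<^sup>2 / (4 * y)) + (moment 0 k - 4 / x\<^sup>2) * (x\<^sup>2 / 4)"
    using x y by (simp add: E_def field_simps)
  also have "\<bar>\<dots>\<bar> \<le> \<bar>M - y * moment 0 k\<bar> * (x\<^sup>2 / (4 * y)) + \<bar>moment 0 k - 4 / x\<^sup>2\<bar> * (x\<^sup>2 / 4)"
    using x y by (intro order.trans[OF abs_triangle_ineq]) (simp add: abs_mult)
  also have "\<dots> \<le> 6 * (x\<^sup>2 / (4 * y)) + 324 * (ln x)\<^sup>2 / x ^ 3 * (x\<^sup>2 / 4)"
    using expected_second_degree_count_linear[of n k] mass_estimate[OF k] n k x y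
    by (intro add_mono mult_right_mono) (auto simp: M_def x_def y_def)
  \<comment> \<open>The constant \<open>81 = 324 / 4\<close> comes from \<open>mass_estimate\<close>
    and dominates \<open>3/2 = 6 / 4\<close>.\<close>
  also have "\<dots> = 3 / 2 * (x\<^sup>2 / y) + 81 * ((ln x)\<^sup>2 / x)"
    using x by (simp add: power2_eq_square power3_eq_cube)
  also have "\<dots> \<le> 81 * ((ln x)\<^sup>2 / x + x\<^sup>2 / y)"
  proof -
    have "3 / 2 * a + 81 * b \<le> 81 * (b + a)" if "a \<ge> 0" for a b :: real using that by simp
    then show ?thesis using y by (metis divide_nonneg_pos zero_le_power2)
  qed
  finally have "\<bar>E\<bar> \<le> 81 * ((ln x)\<^sup>2 / x + x\<^sup>2 / y)" .
  moreover have "M = 4 * y / x\<^sup>2 * (1 + E)" using x y by (simp add: E_def)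
  ultimately show "\<exists>E. expected_second_degree_count n k = 4 * real n / (real k)^2 * (1 + E) \<and>
      \<bar>E\<bar> \<le> 81 * ((ln (real k))^2 / real k + (real k)^2 / real n)"
    unfolding M_def x_def y_def by blast
qed simp

end
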